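(* Let $i\in\{0,1,2\}$, let $n\ge 1$ and $r\ge 1$ be integers, and let $u\in H^r_i$. Then, for every integer $p\ge \max\{r-1,1\}$, there exists an element $R^{\mathrm{opt}}_{p,n,i}u\in \mathbb{S}^{\mathrm{opt}}_{p,n,i}$ such that $$\|(u-R^{\mathrm{opt}}_{p,n,i}u)^{(\ell)}\|\le\left(\frac{h^{\mathrm{opt}}_{p,n,i}}{\pi}\right)^{r-\ell}\|u^{(r)}\|,\qquad \ell=0,1.$$
   Context: All functions are real-valued on $(0,1)$; $\|\cdot\|$ is the $L^2(0,1)$-norm, and $H^r=H^r(0,1)$ is the Sobolev space of functions in $L^2(0,1)$ with derivatives up to order $r$ in $L^2(0,1)$. Function spaces: - $H^r_0=\{u\in H^r: u^{(\alpha)}(0)=u^{(\alpha)}(1)=0,\ 0\le\alpha<r,\ \alpha\text{ even}\}$; - $H^r_1=\{u\in H^r: u^{(\alpha)}(0)=u^{(\alpha)}(1)=0,\ 0\le\alpha<r,\ \alpha\text{ odd}\}$; - $H^r_2=\{u\in H^r: u^{(\alpha_0)}(0)=u^{(\alpha_1)}(1)=0,\ 0\le\alpha_0,\alpha_1<r,\ \alpha_0\text{ even},\ \alpha_1\text{ odd}\}$. Splines: for break points $\boldsymbol\tau=(0=\tau_0<\tau_1<\dots<\tau_{n_{\mathrm{el}}}=1)$ and $p\ge1$, $\mathbb{S}_{p,\boldsymbol\tau}$ is the space of $s\in C^{p-1}[0,1]$ that are polynomials of degree at most $p$ on each $[\tau_{j-1},\tau_j)$, $j<n_{\mathrm{el}}$,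 and on $[\tau_{n_{\mathrm{el}}-1},\tau_{n_{\mathrm{el}}}]$. Set (derivatives at the endpoints are one-sided) - $\mathbb{S}^p_{p,\boldsymbol\tau,0}=\{s\in\mathbb{S}_{p,\boldsymbol\tau}: s^{(\alpha)}(0)=s^{(\alpha)}(1)=0,\ 0\le\alpha\le p,\ \alpha\text{ even}\}$; - $\mathbb{S}^p_{p,\boldsymbol\tau,1}=\{s\in\mathbb{S}_{p,\boldsymbol\tau}: s^{(\alpha)}(0)=s^{(\alpha)}(1)=0,\ 0\le\alpha\le p,\ \alpha\text{ odd}\}$; - $\mathbb{S}^p_{p,\boldsymbol\tau,2}=\{s\in\mathbb{S}_{p,\boldsymbol\tau}: s^{(\alpha_0)}(0)=s^{(\alpha_1)}(1)=0,\ 0\le\alpha_0,\alpha_1\le p,\ \alpha_0\text{ even},\ \alpha_1\text{ odd}\}$. Optimal break points: - $\boldsymbol\tau^{\mathrm{opt}}_{p,n,0}=\left(0,\frac{1}{n+1},\frac{2}{n+1},\dots,\frac{n}{n+1},1\right)$ for $p$ odd, and $\left(0,\frac{1/2}{n+1},\frac{3/2}{n+1},\dots,\frac{n+1/2}{n+1},1\right)$ for $p$ even; - $\boldsymbol\tau^{\mathrm{opt}}_{p,n,1}=\left(0,\frac{1/2}{n},\frac{3/2}{n},\dots,\frac{n-1/2}{n},1\right)$ for $p$ odd, and $\left(0,\frac1n,\frac2n,\dots,\frac{n-1}{n},1\right)$ for $p$ even; - $\boldsymbol\tau^{\mathrm{opt}}_{p,n,2}=\left(0,\frac{2}{2n+1},\frac{4}{2n+1},\dots,\frac{2n}{2n+1},1\right)$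 for $p$ odd, and $\left(0,\frac{1}{2n+1},\frac{3}{2n+1},\dots,\frac{2n-1}{2n+1},1\right)$ for $p$ even. The optimal spline spaces are $\mathbb{S}^{\mathrm{opt}}_{p,n,i}:=\mathbb{S}^p_{p,\boldsymbol\tau^{\mathrm{opt}}_{p,n,i},i}$ (each of dimension $n$), and the grid sizes are $h^{\mathrm{opt}}_{p,n,0}=\frac1{n+1}$, $h^{\mathrm{opt}}_{p,n,1}=\frac1n$, $h^{\mathrm{opt}}_{p,n,2}=\frac{2}{2n+1}$. *)

theory Defs
  imports "HOL-Analysis.Analysis" "HOL-Computational_Algebra.Polynomial"
begin

text \<open>Elements of \<open>L\<^sup>2(0,1)\<close> are represented by functions on the reals; values outside the open
  unit interval are irrelevant, and everything below is invariant under changes on null sets.\<close>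

definition L2 :: "(real \<Rightarrow> real) set" where
  "L2 = {f. f \<in> borel_measurable (lebesgue_on {0<..<1}) \<and>
            integrable (lebesgue_on {0<..<1}) (\<lambda>x. (f x)\<^sup>2)}"

definition L2_norm :: "(real \<Rightarrow> real) \<Rightarrow> real" where
  "L2_norm f = sqrt (\<integral>x. (f x)\<^sup>2 \<partial>lebesgue_on {0<..<1})"

text \<open>Smooth functions with compact support in the open unit interval.\<close>

definition test_functions :: "(real \<Rightarrow> real) set" where
  "test_functions = {\<phi>. (\<forall>k x. (deriv ^^ k) \<phi> field_differentiable at x) \<and>
                       closure {x. \<phi> x \<noteq> 0} \<subseteq> {0<..<1}}"

definition is_weak_deriv :: "nat \<Rightarrow> (real \<Rightarrow> real) \<Rightarrow> (real \<Rightarrow> real) \<Rightarrow> bool" where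
  "is_weak_deriv \<alpha> u v \<longleftrightarrow> u \<in> L2 \<and> v \<in> L2 \<and>
     (\<forall>\<phi>\<in>test_functions.
        (\<integral>x. u x * (deriv ^^ \<alpha>) \<phi> x \<partial>lebesgue_on {0<..<1}) =
        (-1) ^ \<alpha> * (\<integral>x. v x * \<phi> x \<partial>lebesgue_on {0<..<1}))"

text \<open>If a weak derivative in \<open>L\<^sup>2(0,1)\<close> exists, it is unique up to null sets, so the choice
  below is immaterial.\<close>

definition weak_deriv :: "nat \<Rightarrow> (real \<Rightarrow> real) \<Rightarrow> (real \<Rightarrow> real)" where
  "weak_deriv \<alpha> u = (SOME v. is_weak_deriv \<alpha> u v)"

definition sobolev :: "nat \<Rightarrow> (real \<Rightarrow> real) set" where
  "sobolev r = {u \<in> L2. \<forall>\<alpha>\<le>r. \<exists>v. is_weak_deriv \<alpha> u v}"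

text \<open>For \<open>u\<close> in \<open>H\<^sup>r\<close> and \<open>\<alpha> < r\<close>, the \<open>\<alpha>\<close>-th weak derivative of \<open>u\<close> agrees almost everywhere
  with a function continuous on the closed unit interval, which is uniquely determined there.
  Its endpoint values are the boundary values of the \<open>\<alpha>\<close>-th derivative of \<open>u\<close>.\<close>

definition cont_rep :: "(real \<Rightarrow> real) \<Rightarrow> (real \<Rightarrow> real)" where
  "cont_rep v = (SOME w. continuous_on {0..1} w \<and> (AE x in lebesgue_on {0<..<1}. w x = v x))"

text \<open>The three types of boundary conditions, for derivative orders in \<open>A\<close>, where \<open>D \<alpha>\<close> is the
  \<open>\<alpha>\<close>-th derivative. The last branch is intended for \<open>i = 2\<close>.\<close>

definition boundary_cond :: "nat \<Rightarrow> nat set \<Rightarrow> (nat \<Rightarrow> real \<Rightarrow> real) \<Rightarrow> bool" where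
  "boundary_cond i A D \<longleftrightarrow>
     (if i = 0 then \<forall>\<alpha>\<in>A. even \<alpha> \<longrightarrow> D \<alpha> 0 = 0 \<and> D \<alpha> 1 = 0
      else if i = 1 then \<forall>\<alpha>\<in>A. odd \<alpha> \<longrightarrow> D \<alpha> 0 = 0 \<and> D \<alpha> 1 = 0
      else (\<forall>\<alpha>\<in>A. even \<alpha> \<longrightarrow> D \<alpha> 0 = 0) \<and> (\<forall>\<alpha>\<in>A. odd \<alpha> \<longrightarrow> D \<alpha> 1 = 0))"

definition sobolev_bc :: "nat \<Rightarrow> nat \<Rightarrow> (real \<Rightarrow> real) set" where
  "sobolev_bc r i =
     {u \<in> sobolev r. boundary_cond i {..<r} (\<lambda>\<alpha>. cont_rep (weak_deriv \<alpha> u))}"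

text \<open>Iterated classical derivative on the closed unit interval, one-sided at the endpoints.\<close>

primrec deriv01 :: "nat \<Rightarrow> (real \<Rightarrow> real) \<Rightarrow> real \<Rightarrow> real" where
  "deriv01 0 f = f"
| "deriv01 (Suc k) f = (\<lambda>x. vector_derivative (deriv01 k f) (at x within {0..1}))"

definition Ck01 :: "nat \<Rightarrow> (real \<Rightarrow> real) set" where
  "Ck01 k = {f. (\<forall>j<k. deriv01 j f differentiable_on {0..1}) \<and>
                continuous_on {0..1} (deriv01 k f)}"

text \<open>Break points are given as the increasing list \<open>[\<tau>\<^sub>0, \<dots>, \<tau>\<^sub>m]\<close> with first entry \<open>0\<close> and last
  entry \<open>1\<close>. All pieces are half-open except for the last one, which is closed.\<close>

definition piece :: "real list \<Rightarrow> nat \<Rightarrow> real set" where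
  "piece \<tau> j = (if Suc (Suc j) = length \<tau> then {\<tau> ! j..\<tau> ! Suc j} else {\<tau> ! j..<\<tau> ! Suc j})"

definition spline :: "nat \<Rightarrow> real list \<Rightarrow> (real \<Rightarrow> real) set" where
  "spline p \<tau> = {s \<in> Ck01 (p - 1).
     \<forall>j. Suc j < length \<tau> \<longrightarrow>
       (\<exists>q :: real poly. degree q \<le> p \<and> (\<forall>x\<in>piece \<tau> j. s x = poly q x))}"

text \<open>The condition also involves order \<open>p\<close>; the \<open>p\<close>-th derivative of a spline need not exist at
  interior break points, but it does exist (one-sidedly) at the endpoints.\<close>

definition spline_bc :: "nat \<Rightarrow> real list \<Rightarrow> nat \<Rightarrow> (real \<Rightarrow> real) set" where
  "spline_bc p \<tau> i = {s \<in> spline p \<tau>. boundary_cond i {..p} (\<lambda>\<alpha>. deriv01 \<alpha> s)}"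

definition tau_opt :: "nat \<Rightarrow> nat \<Rightarrow> nat \<Rightarrow> real list" where
  "tau_opt p n i = [0] @
     (if i = 0 then
        (if odd p then map (\<lambda>k. real k / (real n + 1)) [1..<n+1]
         else map (\<lambda>k. (real k + 1/2) / (real n + 1)) [0..<n+1])
      else if i = 1 then
        (if odd p then map (\<lambda>k. (real k + 1/2) / real n) [0..<n]
         else map (\<lambda>k. real k / real n) [1..<n])
      else
        (if odd p then map (\<lambda>k. 2 * real k / (2 * real n + 1)) [1..<n+1]
         else map (\<lambda>k. (2 * real k + 1) / (2 * real n + 1)) [0..<n]))
     @ [1]"

definition spline_opt :: "nat \<Rightarrow> nat \<Rightarrow> nat \<Rightarrow> (real \<Rightarrow> real) set" where
  "spline_opt p n i = spline_bc p (tau_opt p n i) i"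

text \<open>The grid size does not depend on the degree.\<close>

definition h_opt :: "nat \<Rightarrow> nat \<Rightarrow> real" where
  "h_opt n i = (if i = 0 then 1 / (real n + 1)
                else if i = 1 then 1 / real n
                else 2 / (2 * real n + 1))"

end

theory Submission
  imports Defs
begin

text \<open>Write \<open>K\<close> for the antiderivative satisfying the boundary conditions of a given type; up to sign,
  its \<open>L\<^sup>2\<close>-adjoint is the antiderivative for the type of the derivative, and both map optimal spline
  spaces of degree \<open>p\<close> to those of degree \<open>p + 1\<close>. For piecewise constants, interpolation at the
  midpoints of the cells approximates \<open>K f\<close> up to \<open>h / \<pi> * \<parallel>f\<parallel>\<close>. If \<open>P\<close> is the orthogonal
  projection onto a spline space approximating the range of \<open>K\<^sup>*\<close> to this accuracy, then
  \<open>K (I - P)\<close>, the adjoint of \<open>(I - P) K\<^sup>*\<close>, has norm at most \<open>h / \<pi>\<close>; since \<open>K P f\<close> is a spline, the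
  same accuracy holds in the next degree, hence in all degrees. The Ritz projection of \<open>u\<close> has
  derivative \<open>P u'\<close>, so \<open>u - R u = K (I - P) u'\<close>, and every further derivative of \<open>u\<close> gains one
  more factor \<open>h / \<pi>\<close>.\<close>

subsection \<open>The inner product on the unit interval\<close>

text \<open>Differentiation exchanges types 0 and 1 but changes the dimension: derivatives of type 1
  splines with parameter \<open>n\<close> are type 0 splines with parameter \<open>n - 1\<close>.
  What stays fixed is the number \<open>M = 2 / h\<close> of half cells, so \<open>M\<close> and a
  parity replace \<open>n\<close> and the three types, and one induction over the degree covers all
  cases. The constant comes from a single half cell: a function vanishing at one end of an interval
  of length \<open>1 / M\<close> is bounded in norm by \<open>2 / (M * pi)\<close> times its
  derivative, the extremal being a quarter wave of the sine. A cell consists of two half cells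
  meeting at its midpoint, where the interpolation error vanishes; a cell cut by an end of the unit
  interval is a single half cell, and there the boundary condition supplies the midpoint value. The
  delicate type has no prescribed end values (odd \<open>i\<close>, even \<open>M\<close>):
  antiderivatives are fixed only up to a constant, \<open>K\<close> selects the one of mean zero,
  and constants are put into the spline spaces separately.\<close>

abbreviation L01 :: "real measure" where
  "L01 \<equiv> lebesgue_on {0<..<1}"

definition ip :: "(real \<Rightarrow> real) \<Rightarrow> (real \<Rightarrow> real) \<Rightarrow> real" where
  "ip f g = (\<integral>x. f x * g x \<partial>L01)"

lemma finite_measure_L01: "finite_measure L01"
  by (rule finite_measure_lebesgue_on) simp

lemma measure_L01: "measure L01 (space L01) = 1"
  by (simp add: measure_restrict_space)

interpretation L01: finite_measure L01
  by (rule finite_measure_L01)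

interpretation L01: pair_sigma_finite L01 L01
  by unfold_locales

lemma borel_measurable_L01:
  "f \<in> borel_measurable borel \<Longrightarrow> f \<in> borel_measurable L01"
  by (intro measurable_restrict_space1 measurable_completion) simp

lemma L2_measurable: "f \<in> L2 \<Longrightarrow> f \<in> borel_measurable L01"
  by (simp add: L2_def)

lemma L2_square_integrable: "f \<in> L2 \<Longrightarrow> integrable L01 (\<lambda>x. (f x)\<^sup>2)"
  by (simp add: L2_def)

lemma L2_mult_integrable:
  assumes "f \<in> L2" "g \<in> L2"
  shows "integrable L01 (\<lambda>x. f x * g x)"
proof (rule Bochner_Integration.integrable_bound)
  show "integrable L01 (\<lambda>x. (f x)\<^sup>2 + (g x)\<^sup>2)"
    using assms by (intro Bochner_Integration.integrable_add L2_square_integrable)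
  show "(\<lambda>x. f x * g x) \<in> borel_measurable L01"
    using assms by (intro borel_measurable_times L2_measurable)
  show "AE x in L01. norm (f x * g x) \<le> norm ((f x)\<^sup>2 + (g x)\<^sup>2)"
  proof (rule AE_I2)
    fix x
    have "\<bar>f x * g x\<bar> \<le> (f x)\<^sup>2 + (g x)\<^sup>2"
      using sum_squares_bound[of "\<bar>f x\<bar>" "\<bar>g x\<bar>"] mult_nonneg_nonneg[OF abs_ge_zero[of "f x"] abs_ge_zero[of "g x"]]
      unfolding abs_mult power2_abs by linarith
    then show "norm (f x * g x) \<le> norm ((f x)\<^sup>2 + (g x)\<^sup>2)"
      by simp
  qed
qed

lemma L2_bounded:
  assumes "f \<in> borel_measurable L01" "\<And>x. x \<in> {0<..<1} \<Longrightarrow> \<bar>f x\<bar> \<le> B"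
  shows "f \<in> L2"
proof -
  have "integrable L01 (\<lambda>x. (f x)\<^sup>2)"
  proof (rule L01.integrable_const_bound[where B = "B\<^sup>2"])
    show "AE x in L01. norm ((f x)\<^sup>2) \<le> B\<^sup>2"
    proof (rule AE_I2)
      fix x assume "x \<in> space L01"
      then have "\<bar>f x\<bar> \<le> B" using assms(2) by auto
      then show "norm ((f x)\<^sup>2) \<le> B\<^sup>2"
        using abs_le_square_iff[of "f x" B] by auto
    qed
  qed (use assms(1) in auto)
  then show ?thesis using assms(1) by (simp add: L2_def)
qed

lemma L2_const [simp]: "(\<lambda>_. c) \<in> L2"
  by (rule L2_bounded[where B = "\<bar>c\<bar>"]) auto

lemma L2_continuous_on:
  assumes "continuous_on {0..1} f"
  shows "f \<in> L2"
proof -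
  have "bounded (f ` {0..1})"
    using assms compact_Icc compact_continuous_image compact_imp_bounded by blast
  then obtain B where B: "\<And>x. x \<in> {0..1} \<Longrightarrow> \<bar>f x\<bar> \<le> B"
    unfolding bounded_iff by fastforce
  have "f \<in> borel_measurable L01"
    by (rule continuous_imp_measurable_on_sets_lebesgue)
       (use assms in \<open>auto intro: continuous_on_subset\<close>)
  then show ?thesis
    by (rule L2_bounded[where B = B]) (use B in auto)
qed

lemma L2_integrable:
  assumes "f \<in> L2"
  shows "integrable L01 f"
  using L2_mult_integrable[OF assms L2_const[of 1]] by simp

lemma L2_add [intro]:
  assumes "f \<in> L2" "g \<in> L2"
  shows "(\<lambda>x. f x + g x) \<in> L2"
proof -
  have "integrable L01 (\<lambda>x. (f x)\<^sup>2 + 2 * (f x * g x) + (g x)\<^sup>2)"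
    using assms by (intro Bochner_Integration.integrable_add L2_square_integrable integrable_mult_right L2_mult_integrable)
  then show ?thesis
    using assms by (auto simp: L2_def power2_sum algebra_simps)
qed

lemma L2_cmult [intro]: "f \<in> L2 \<Longrightarrow> (\<lambda>x. c * f x) \<in> L2"
  by (auto simp: L2_def power_mult_distrib)

lemma L2_diff [intro]:
  assumes "f \<in> L2" "g \<in> L2"
  shows "(\<lambda>x. f x - g x) \<in> L2"
  using L2_add[OF assms(1) L2_cmult[OF assms(2), of "-1"]] by simp

lemma L2_cong_AE:
  assumes "f \<in> L2" "AE x in L01. f x = g x"
  shows "g \<in> L2"
proof -
  define e :: "(real \<Rightarrow> real) \<Rightarrow> real \<Rightarrow> real" where "e h x = (if x \<in> {0<..<1} then h x else 0)" for h x
  have "e f \<in> borel_measurable lebesgue"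
    unfolding e_def using assms(1) by (intro borel_measurable_if_I) (auto simp: L2_def)
  moreover have "AE x in lebesgue. e f x = e g x"
    using assms(2) by (simp add: AE_restrict_space_iff e_def)
  ultimately have "e g \<in> borel_measurable lebesgue"
    by (rule borel_measurable_AE)
  then have g: "g \<in> borel_measurable L01"
    unfolding e_def by (rule borel_measurable_if_D)
  moreover have "integrable L01 (\<lambda>x. (f x)\<^sup>2) \<longleftrightarrow> integrable L01 (\<lambda>x. (g x)\<^sup>2)"
    using assms g by (intro integrable_cong_AE) (auto simp: L2_def)
  ultimately show ?thesis
    using assms by (simp add: L2_def)
qed

lemma ip_commute: "ip f g = ip g f"
  by (simp add: ip_def mult.commute)

lemma ip_add_left:
  assumes "f \<in> L2" "g \<in> L2" "h \<in> L2"
  shows "ip (\<lambda>x. f x + g x) h = ip f h + ip g h"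
  using assms by (simp add: ip_def distrib_right L2_mult_integrable)

lemma ip_diff_left:
  assumes "f \<in> L2" "g \<in> L2" "h \<in> L2"
  shows "ip (\<lambda>x. f x - g x) h = ip f h - ip g h"
  using assms by (simp add: ip_def left_diff_distrib L2_mult_integrable)

lemma ip_cmult_left: "ip (\<lambda>x. c * f x) h = c * ip f h"
  by (simp add: ip_def mult.assoc)

lemma ip_add_right:
  assumes "f \<in> L2" "g \<in> L2" "h \<in> L2"
  shows "ip h (\<lambda>x. f x + g x) = ip h f + ip h g"
  using assms by (simp add: ip_commute[of h] ip_add_left)

lemma ip_diff_right:
  assumes "f \<in> L2" "g \<in> L2" "h \<in> L2"
  shows "ip h (\<lambda>x. f x - g x) = ip h f - ip h g"
  using assms by (simp add: ip_commute[of h] ip_diff_left)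

lemma ip_cmult_right: "ip h (\<lambda>x. c * f x) = c * ip h f"
  by (simp add: ip_commute[of h] ip_cmult_left)

lemmas ip_linear = ip_add_left ip_diff_left ip_cmult_left ip_add_right ip_diff_right ip_cmult_right

lemma ip_self_nonneg: "0 \<le> ip f f"
  by (simp add: ip_def)

lemma L2_norm_eq: "L2_norm f = sqrt (ip f f)"
  by (simp add: L2_norm_def ip_def power2_eq_square)

lemma L2_norm_nonneg [simp]: "0 \<le> L2_norm f"
  by (simp add: L2_norm_def)

lemma L2_norm_power2: "(L2_norm f)\<^sup>2 = ip f f"
  by (simp add: L2_norm_eq ip_self_nonneg)

lemma L2_norm_cong_AE:
  assumes "f \<in> L2" "AE x in L01. f x = g x"
  shows "L2_norm f = L2_norm g"
proof -
  have "g \<in> L2" using assms by (rule L2_cong_AE)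
  then have "(\<integral>x. (f x)\<^sup>2 \<partial>L01) = (\<integral>x. (g x)\<^sup>2 \<partial>L01)"
    using assms by (intro integral_cong_AE) (auto simp: L2_def)
  then show ?thesis by (simp add: L2_norm_def)
qed

lemma L2_norm_cong:
  assumes "\<And>x. x \<in> {0<..<1} \<Longrightarrow> f x = g x"
  shows "L2_norm f = L2_norm g"
proof -
  have "(\<integral>x. (f x)\<^sup>2 \<partial>L01) = (\<integral>x. (g x)\<^sup>2 \<partial>L01)"
    using assms by (intro Bochner_Integration.integral_cong) auto
  then show ?thesis by (simp add: L2_norm_def)
qed

lemma ip_Cauchy_Schwarz:
  assumes f: "f \<in> L2" and g: "g \<in> L2"
  shows "\<bar>ip f g\<bar> \<le> L2_norm f * L2_norm g"
proof -
  define F G where "F = L2_norm f" and "G = L2_norm g"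
  have key: "0 \<le> F\<^sup>2 + 2 * t * ip f g + t\<^sup>2 * G\<^sup>2" for t
  proof -
    have "0 \<le> ip (\<lambda>x. f x + t * g x) (\<lambda>x. f x + t * g x)" by (rule ip_self_nonneg)
    also have "\<dots> = F\<^sup>2 + 2 * t * ip f g + t\<^sup>2 * G\<^sup>2"
      using f g by (simp add: ip_linear L2_add L2_cmult F_def G_def L2_norm_power2 ip_commute[of g f]
          power2_eq_square[of t] distrib_left mult.assoc)
    finally show ?thesis .
  qed
  have "(ip f g)\<^sup>2 \<le> F\<^sup>2 * G\<^sup>2"
  proof (cases "G = 0")
    case True
    have "ip f g = 0"
    proof (rule ccontr)
      assume ne: "ip f g \<noteq> 0"
      \<comment> \<open>At this \<open>t\<close> the quadratic equals -1, since its leading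
        coefficient vanishes.\<close>
      show False using key[of "- (F\<^sup>2 + 1) / (2 * ip f g)"] ne True by (simp add: field_simps)
    qed
    then show ?thesis by simp
  next
    case False
    then have G: "G\<^sup>2 > 0" by simp
    have "2 * (- ip f g / G\<^sup>2) * ip f g = - 2 * ((ip f g)\<^sup>2 / G\<^sup>2)"
      by (simp add: power2_eq_square[of "ip f g"])
    moreover have "(- ip f g / G\<^sup>2)\<^sup>2 * G\<^sup>2 = (ip f g)\<^sup>2 / G\<^sup>2"
      using False by (simp add: power2_eq_square)
    ultimately have "(ip f g)\<^sup>2 / G\<^sup>2 \<le> F\<^sup>2"
      using key[of "- ip f g / G\<^sup>2"] by linarith
    then show ?thesis using G by (simp add: pos_divide_le_eq)
  qed
  then have "\<bar>ip f g\<bar>\<^sup>2 \<le> (F * G)\<^sup>2" by (simp add: power_mult_distrib)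
  moreover have "0 \<le> F * G" by (simp add: F_def G_def)
  ultimately have "\<bar>ip f g\<bar> \<le> F * G" by (rule power2_le_imp_le)
  then show ?thesis by (simp add: F_def G_def)
qed

text \<open>The constant 1 is a unit vector, so removing the mean is an orthogonal projection. This
  serves zero values at both ends, where \<open>K\<close> in effect integrates \<open>f\<close>
  minus its mean.\<close>

lemma L2_norm_mean_le:
  assumes f: "f \<in> L2"
  shows "L2_norm (\<lambda>x. f x - ip f (\<lambda>_. 1)) \<le> L2_norm f"
proof -
  let ?m = "ip f (\<lambda>_. 1)"
  have 1: "ip (\<lambda>_. 1) (\<lambda>_. 1) = 1"
    using measure_L01 by (simp add: ip_def)
  have "ip (\<lambda>x. f x - ?m * 1) (\<lambda>x. f x - ?m * 1) = ip f f - ?m\<^sup>2"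
    unfolding ip_diff_left[OF f L2_const L2_diff[OF f L2_const]] ip_diff_right[OF f L2_const f]
      ip_diff_right[OF f L2_const L2_const] ip_cmult_left ip_cmult_right
    by (simp add: 1 ip_commute[of "\<lambda>_. 1" f] power2_eq_square)
  then show ?thesis
    by (simp add: L2_norm_eq)
qed

subsection \<open>Finitely generated spaces and orthogonal projection\<close>

inductive_set lspan :: "(real \<Rightarrow> real) set \<Rightarrow> (real \<Rightarrow> real) set" for B where
  zero: "(\<lambda>_. 0) \<in> lspan B"
| step: "b \<in> B \<Longrightarrow> s \<in> lspan B \<Longrightarrow> (\<lambda>x. a * b x + s x) \<in> lspan B"

lemma lspan_base: "b \<in> B \<Longrightarrow> (\<lambda>x. a * b x) \<in> lspan B"
  using lspan.step[OF _ lspan.zero, of b B a] by simp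

lemma lspan_add: "s \<in> lspan B \<Longrightarrow> t \<in> lspan B \<Longrightarrow> (\<lambda>x. s x + t x) \<in> lspan B"
proof (induction rule: lspan.induct)
  case zero
  then show ?case by simp
next
  case (step b s a)
  from lspan.step[OF step(1) step(3)[OF step(4)], of a] show ?case by (simp add: add.assoc)
qed

lemma lspan_cmult: "s \<in> lspan B \<Longrightarrow> (\<lambda>x. c * s x) \<in> lspan B"
proof (induction rule: lspan.induct)
  case zero
  then show ?case using lspan.zero[of B] by simp
next
  case (step b s a)
  from lspan.step[OF step(1) step(3), of "c * a"] show ?case by (simp add: distrib_left mult.assoc)
qed

lemma lspan_mono: "s \<in> lspan A \<Longrightarrow> A \<subseteq> B \<Longrightarrow> s \<in> lspan B"
  by (induction rule: lspan.induct) (auto intro: lspan.intros)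

lemma lspan_sum:
  assumes "\<And>j. j \<in> A \<Longrightarrow> b j \<in> B"
  shows "(\<lambda>x. \<Sum>j\<in>A. a j * b j x) \<in> lspan B"
  using assms
  by (induction A rule: infinite_finite_induct) (auto intro: lspan.intros)

lemma lspan_L2: "s \<in> lspan B \<Longrightarrow> B \<subseteq> L2 \<Longrightarrow> s \<in> L2"
proof (induction rule: lspan.induct)
  case (step b s a)
  then show ?case by (intro L2_add L2_cmult) auto
qed simp

lemma lspan_orthogonal:
  assumes "s \<in> lspan B" "B \<subseteq> L2" "f \<in> L2" "\<And>b. b \<in> B \<Longrightarrow> ip f b = 0"
  shows "ip f s = 0"
  using assms
proof (induction rule: lspan.induct)
  case zero
  then show ?case by (simp add: ip_def)
next
  case (step b s a)
  then have "b \<in> L2" "s \<in> L2" using lspan_L2 by auto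
  with step show ?case by (simp add: ip_linear L2_cmult)
qed

text \<open>Gram-Schmidt: the residual \<open>e\<close> of the new generator is orthogonal to the
  old span, so moving along \<open>e\<close> repairs orthogonality to \<open>b\<close> without
  spoiling the rest.\<close>

lemma orthogonal_projection:
  assumes "finite B" "B \<subseteq> L2" "f \<in> L2"
  shows "\<exists>s\<in>lspan B. \<forall>b\<in>B. ip (\<lambda>x. f x - s x) b = 0"
  using assms
proof (induction B arbitrary: f rule: finite_induct)
  case empty
  then show ?case using lspan.zero by blast
next
  case (insert b B f)
  have b: "b \<in> L2" and B: "B \<subseteq> L2" using insert by auto
  obtain s where s: "s \<in> lspan B" "\<And>c. c \<in> B \<Longrightarrow> ip (\<lambda>x. f x - s x) c = 0"
    using insert.IH[OF B insert.prems(2)] by auto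
  obtain t where t: "t \<in> lspan B" "\<And>c. c \<in> B \<Longrightarrow> ip (\<lambda>x. b x - t x) c = 0"
    using insert.IH[OF B b] by auto
  have sL: "s \<in> L2" and tL: "t \<in> L2" using s t lspan_L2 B by auto
  define e where "e = (\<lambda>x. b x - t x)"
  define g where "g = (\<lambda>x. f x - s x)"
  have eL: "e \<in> L2" and gL: "g \<in> L2" using sL tL b insert.prems unfolding e_def g_def by auto
  define a where "a = ip g e / ip e e"
  have orth: "ip g e - a * ip e e = 0"
  proof (cases "ip e e = 0")
    \<comment> \<open>The new generator may depend on the old ones up to a null set; Cauchy-Schwarz
      then makes the defect vanish whatever \<open>a\<close> is.\<close>
    case True
    then have "ip g e = 0" using ip_Cauchy_Schwarz[OF gL eL] by (simp add: L2_norm_eq)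
    then show ?thesis using True by simp
  qed (simp add: a_def)
  define w where "w = (\<lambda>x. s x + a * e x)"
  have gw: "(\<lambda>x. f x - w x) = (\<lambda>x. g x - a * e x)"
    by (auto simp: w_def g_def)
  have "w \<in> lspan (insert b B)"
  proof -
    have "(\<lambda>x. a * b x + (s x + (-a) * t x)) \<in> lspan (insert b B)"
      using s(1) t(1) by (intro lspan.step lspan_add lspan_cmult) (auto intro: lspan_mono)
    moreover have "(\<lambda>x. a * b x + (s x + (-a) * t x)) = w"
      by (auto simp: w_def e_def algebra_simps)
    ultimately show ?thesis by simp
  qed
  moreover have c: "ip (\<lambda>x. g x - a * e x) c = 0" if "c \<in> B" for c
    using that s(2) t(2) B eL gL by (simp add: ip_linear L2_cmult subset_iff g_def[symmetric] e_def[symmetric])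
  moreover have "ip (\<lambda>x. g x - a * e x) b = 0"
  proof -
    have "ip (\<lambda>x. g x - a * e x) t = 0"
      using lspan_orthogonal[OF t(1) B L2_diff[OF gL L2_cmult[OF eL]] c] .
    moreover have "ip (\<lambda>x. g x - a * e x) e = 0"
      using orth eL gL by (simp add: ip_linear L2_cmult)
    moreover have "b = (\<lambda>x. e x + t x)" by (auto simp: e_def)
    ultimately show ?thesis
      using eL gL tL by (simp add: ip_add_right L2_diff L2_cmult)
  qed
  ultimately show ?case using gw by (intro bexI[of _ w]) auto
qed

text \<open>The Aubin-Nitsche argument: pairing \<open>K f\<close> with itself produces
  \<open>K' (K f)\<close> against \<open>f\<close>, and orthogonality of \<open>f\<close> to
  \<open>S\<close> allows a good approximant of that function to be subtracted before
  Cauchy-Schwarz.\<close>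

lemma duality_bound:
  assumes adj: "\<And>g. g \<in> L2 \<Longrightarrow> ip (K f) g = - ip f (K' g)"
    and K: "K f \<in> L2" and K': "\<And>g. g \<in> L2 \<Longrightarrow> K' g \<in> L2"
    and approx: "\<And>g. g \<in> L2 \<Longrightarrow> \<exists>s\<in>S. L2_norm (\<lambda>x. K' g x - s x) \<le> c * L2_norm g"
    and S: "S \<subseteq> L2" and f: "f \<in> L2" "\<And>s. s \<in> S \<Longrightarrow> ip f s = 0"
  shows "L2_norm (K f) \<le> c * L2_norm f"
proof (cases "L2_norm (K f) = 0")
  case True
  obtain s where "L2_norm (\<lambda>x. K' f x - s x) \<le> c * L2_norm f"
    using approx[OF f(1)] by auto
  then show ?thesis using True L2_norm_nonneg order_trans by metis
next
  case False
  let ?g = "K f"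
  obtain s where s: "s \<in> S" "L2_norm (\<lambda>x. K' ?g x - s x) \<le> c * L2_norm ?g"
    using approx[OF K] by auto
  have "(L2_norm ?g)\<^sup>2 = - ip f (K' ?g)"
    by (simp add: L2_norm_power2 adj[OF K])
  also have "\<dots> = - ip f (\<lambda>x. K' ?g x - s x)"
    using f s S K K' by (simp add: ip_diff_right subset_iff)
  also have "\<dots> \<le> L2_norm f * L2_norm (\<lambda>x. K' ?g x - s x)"
    using ip_Cauchy_Schwarz[OF f(1) L2_diff[OF K'[OF K] subsetD[OF S s(1)]]] by linarith
  also have "\<dots> \<le> L2_norm f * (c * L2_norm ?g)"
    using s by (intro mult_left_mono) auto
  finally have "L2_norm ?g * L2_norm ?g \<le> (c * L2_norm f) * L2_norm ?g"
    by (simp add: power2_eq_square mult_ac)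
  then show ?thesis using False L2_norm_nonneg[of ?g] by (simp add: mult_le_cancel_right)
qed

subsection \<open>The integration operator\<close>

text \<open>The cutoff sits in the integrand so that every \<open>J f x\<close> is an integral over
  the same measure, as suits Fubini. It also makes \<open>J f\<close> constant to the left of 0 and
  to the right of 1, hence continuous on the whole line.\<close>

definition J :: "(real \<Rightarrow> real) \<Rightarrow> real \<Rightarrow> real" where
  "J f x = (\<integral>t. (if t \<le> x then f t else 0) \<partial>L01)"

lemma L01_integrable_if:
  assumes "integrable L01 f" "S \<in> sets borel"
  shows "integrable L01 (\<lambda>t. if t \<in> S then f t else (0::real))"
proof (rule Bochner_Integration.integrable_bound[OF assms(1)])
  have "(\<lambda>t. indicator S t * f t) \<in> borel_measurable L01"
    by (rule borel_measurable_times[OF borel_measurable_L01[OF borel_measurable_indicator[OF assms(2)]]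
          borel_measurable_integrable[OF assms(1)]])
  moreover have "(\<lambda>t. indicator S t * f t) = (\<lambda>t. if t \<in> S then f t else 0)"
    by (auto simp: indicator_def)
  ultimately show "(\<lambda>t. if t \<in> S then f t else 0) \<in> borel_measurable L01"
    by simp
qed auto

lemma J_integrable: "f \<in> L2 \<Longrightarrow> integrable L01 (\<lambda>t. if t \<le> x then f t else 0)"
  using L01_integrable_if[OF L2_integrable, of f "{..x}"] by simp

lemma J_add: "f \<in> L2 \<Longrightarrow> g \<in> L2 \<Longrightarrow> J (\<lambda>x. f x + g x) x = J f x + J g x"
  unfolding J_def
  by (subst Bochner_Integration.integral_add[symmetric])
    (auto intro!: J_integrable Bochner_Integration.integral_cong)

lemma J_diff: "f \<in> L2 \<Longrightarrow> g \<in> L2 \<Longrightarrow> J (\<lambda>x. f x - g x) x = J f x - J g x"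
  unfolding J_def
  by (subst Bochner_Integration.integral_diff[symmetric])
    (auto intro!: J_integrable Bochner_Integration.integral_cong)

lemma J_cmult: "J (\<lambda>x. c * f x) x = c * J f x"
proof -
  have "(\<lambda>t. if t \<le> x then c * f t else 0) = (\<lambda>t. c * (if t \<le> x then f t else 0))"
    by auto
  then show ?thesis by (simp add: J_def)
qed

lemma J_zero [simp]: "J (\<lambda>_. 0) x = 0"
  by (simp add: J_def)

lemma J_0 [simp]: "J f 0 = 0"
proof -
  have "J f 0 = (\<integral>t. 0 \<partial>L01)"
    unfolding J_def by (intro Bochner_Integration.integral_cong) auto
  then show ?thesis by simp
qed

lemma J_1: "J f 1 = ip f (\<lambda>_. 1)"
  unfolding J_def ip_def by (intro Bochner_Integration.integral_cong) auto

lemma J_cong: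
  assumes "\<And>t. 0 < t \<Longrightarrow> t < 1 \<Longrightarrow> t \<le> x \<Longrightarrow> f t = g t"
  shows "J f x = J g x"
  unfolding J_def using assms by (intro Bochner_Integration.integral_cong) auto

lemma J_cong_AE:
  assumes "f \<in> L2" "AE x in L01. f x = g x"
  shows "J f x = J g x"
proof -
  have "g \<in> L2" using assms by (rule L2_cong_AE)
  then show ?thesis
    unfolding J_def using assms J_integrable
    by (intro integral_cong_AE) (auto elim: eventually_mono dest: borel_measurable_integrable)
qed

text \<open>Bridge to the gauge integral and its fundamental theorem; the open and the closed
  interval differ by a negligible set.\<close>

lemma J_eq_integral:
  assumes "f \<in> L2" "x \<in> {0..1}"
  shows "f integrable_on {0..x}" "J f x = integral {0..x} f"
proof -
  have eq: "(\<lambda>t. indicator {0<..<1} t *\<^sub>R (if t \<le> x then f t else 0)) = (\<lambda>t. if t \<in> {0<..<1} \<inter> {..x} then f t else 0)"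
    by (auto simp: indicator_def)
  have abs: "(\<lambda>t. if t \<le> x then f t else 0) absolutely_integrable_on {0<..<1}"
    using J_integrable[OF assms(1), of x] by (simp add: set_integrable_def integrable_restrict_space eq)
  then have i: "(\<lambda>t. if t \<le> x then f t else 0) integrable_on {0<..<1}"
    by (rule set_lebesgue_integral_eq_integral(1))
  have J: "J f x = integral {0<..<1} (\<lambda>t. if t \<le> x then f t else 0)"
    unfolding J_def using J_integrable[OF assms(1)] by (rule lebesgue_integral_eq_integral) simp
  have s: "(\<lambda>t. if t \<in> {0<..<1} then (if t \<le> x then f t else 0) else 0) = (\<lambda>t. if t \<in> {0<..<1} \<inter> {..x} then f t else 0)"
    by auto
  have hi: "(f has_integral J f x) ({0<..<1} \<inter> {..x})"
  proof -
    have "((\<lambda>t. if t \<le> x then f t else 0) has_integral J f x) {0<..<1}"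
      unfolding J using i by (rule integrable_integral)
    then show ?thesis
      by (subst (asm) has_integral_restrict_UNIV[symmetric], subst has_integral_restrict_UNIV[symmetric]) (simp only: s)
  qed
  have "(f has_integral J f x) {0..x}"
    by (rule iffD1[OF has_integral_spike_set_eq hi]; rule negligible_subset[of "{0,1,x}"]) (use assms(2) in auto)
  then show "f integrable_on {0..x}" "J f x = integral {0..x} f"
    by (auto simp: integral_unique)
qed

lemma J_continuous: "f \<in> L2 \<Longrightarrow> continuous_on {0..1} (J f)"
  using indefinite_integral_continuous_1[OF J_eq_integral(1)[of f 1]]
  by (subst continuous_on_cong[OF refl J_eq_integral(2)]) auto

lemma J_L2: "f \<in> L2 \<Longrightarrow> J f \<in> L2"
  by (rule L2_continuous_on[OF J_continuous])

lemma J_antiderivative: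
  assumes "f \<in> L2" "0 \<le> a" "a \<le> b" "b \<le> 1" "continuous_on {a..b} F"
    "\<And>x. a < x \<Longrightarrow> x < b \<Longrightarrow> (F has_real_derivative f x) (at x)"
  shows "J f b - J f a = F b - F a"
proof -
  have "(f has_integral F b - F a) {a..b}"
    using assms by (intro fundamental_theorem_of_calculus_interior)
      (auto simp: has_real_derivative_iff_has_vector_derivative[symmetric])
  moreover have "integral {0..b} f = integral {0..a} f + integral {a..b} f"
    using assms J_eq_integral(1)[of f b] by (intro Henstock_Kurzweil_Integration.integral_combine[symmetric]) auto
  ultimately show ?thesis
    using assms J_eq_integral(2)[of f] by (simp add: integral_unique)
qed

lemma J_const: "x \<in> {0..1} \<Longrightarrow> J (\<lambda>_. c) x = c * x"
  using J_antiderivative[of "\<lambda>_. c" 0 x "\<lambda>x. c * x"]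
  by (auto intro!: continuous_intros derivative_eq_intros)

lemma AE_L01_neq: "AE t in L01. t \<noteq> x"
proof -
  have "AE t in lebesgue. t \<noteq> x"
    by (rule AE_I'[of "{x}"]) auto
  then show ?thesis
    by (subst AE_restrict_space_iff) (auto elim: eventually_mono)
qed

section \<open>Fubini and integration by parts\<close>

lemma integrable_prod_L01:
  assumes f: "f \<in> L2" and g: "g \<in> L2" and P: "Measurable.pred (L01 \<Otimes>\<^sub>M L01) (\<lambda>(x, t). P x t)"
  shows "integrable (L01 \<Otimes>\<^sub>M L01) (\<lambda>(x, t). if P x t then f t * g x else 0)"
proof -
  have [measurable]: "f \<in> borel_measurable L01" "g \<in> borel_measurable L01"
    using f g L2_measurable by auto
  have "integrable (L01 \<Otimes>\<^sub>M L01) (\<lambda>(x, t). f t * g x)"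
  proof (rule L01.Fubini_integrable)
    show "integrable L01 (\<lambda>x. \<integral>y. norm (case (x, y) of (x, t) \<Rightarrow> f t * g x) \<partial>L01)"
      using L2_integrable[OF g] by (simp add: abs_mult)
    show "AE x in L01. integrable L01 (\<lambda>y. case (x, y) of (x, t) \<Rightarrow> f t * g x)"
      using L2_integrable[OF f] by (intro AE_I2) simp
  qed measurable
  then show ?thesis
  proof (rule Bochner_Integration.integrable_bound)
    show "(\<lambda>(x, t). if P x t then f t * g x else 0) \<in> borel_measurable (L01 \<Otimes>\<^sub>M L01)"
      using P by (simp add: case_prod_beta')
  qed (auto simp: case_prod_beta')
qed

lemma pred_le_L01:
  "Measurable.pred (L01 \<Otimes>\<^sub>M L01) (\<lambda>(x, t). t \<le> x)"
  "Measurable.pred (L01 \<Otimes>\<^sub>M L01) (\<lambda>(x, t). x \<le> t)"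
proof -
  have [measurable]: "(\<lambda>z. fst z) \<in> borel_measurable (L01 \<Otimes>\<^sub>M L01)" "(\<lambda>z. snd z) \<in> borel_measurable (L01 \<Otimes>\<^sub>M L01)"
    by (rule measurable_compose[OF measurable_fst borel_measurable_L01], simp)
       (rule measurable_compose[OF measurable_snd borel_measurable_L01], simp)
  show "Measurable.pred (L01 \<Otimes>\<^sub>M L01) (\<lambda>(x, t). t \<le> x)"
  "Measurable.pred (L01 \<Otimes>\<^sub>M L01) (\<lambda>(x, t). x \<le> t)"
    unfolding case_prod_beta' by measurable
qed

text \<open>The integrals of \<open>f t * g x\<close> over the two triangles of the unit square add
  up to the product of the full integrals, the shared diagonal being null.\<close>

lemma ip_J:
  assumes f: "f \<in> L2" and g: "g \<in> L2"
  shows "ip (J f) g + ip f (J g) = J f 1 * J g 1"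
proof -
  define A where "A = (\<lambda>x t. if t \<le> x then f t * g x else 0)"
  define B where "B = (\<lambda>x t. if x \<le> t then f t * g x else 0)"
  have A: "integrable (L01 \<Otimes>\<^sub>M L01) (case_prod A)"
    unfolding A_def by (rule integrable_prod_L01[OF f g pred_le_L01(1)])
  have B: "integrable (L01 \<Otimes>\<^sub>M L01) (case_prod B)"
    unfolding B_def by (rule integrable_prod_L01[OF f g pred_le_L01(2)])
  have 1: "J f x * g x = (\<integral>t. A x t \<partial>L01)" for x
    unfolding J_def A_def by (subst integral_mult_left_zero[symmetric]) (intro Bochner_Integration.integral_cong, auto)
  have 2: "f t * J g t = (\<integral>x. B x t \<partial>L01)" for t
    unfolding J_def B_def by (subst integral_mult_right_zero[symmetric]) (intro Bochner_Integration.integral_cong, auto)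
  have Ai: "integrable L01 (\<lambda>t. A x t)" and Bi: "integrable L01 (\<lambda>t. B x t)" for x
    using integrable_mult_left[OF L01_integrable_if[OF L2_integrable[OF f], of "{..x}"], of "g x"]
      integrable_mult_left[OF L01_integrable_if[OF L2_integrable[OF f], of "{x..}"], of "g x"]
    by (auto simp: A_def B_def if_distrib[of "\<lambda>z. z * g x"] cong: if_cong)
  have "ip (J f) g + ip f (J g) = (\<integral>x. (\<integral>t. A x t \<partial>L01) \<partial>L01) + (\<integral>t. (\<integral>x. B x t \<partial>L01) \<partial>L01)"
    by (simp add: ip_def 1 2)
  also have "(\<integral>t. (\<integral>x. B x t \<partial>L01) \<partial>L01) = (\<integral>x. (\<integral>t. B x t \<partial>L01) \<partial>L01)"
    by (rule L01.Fubini_integral[OF B])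
  also have "(\<integral>x. (\<integral>t. A x t \<partial>L01) \<partial>L01) + (\<integral>x. (\<integral>t. B x t \<partial>L01) \<partial>L01)
      = (\<integral>x. (\<integral>t. A x t \<partial>L01) + (\<integral>t. B x t \<partial>L01) \<partial>L01)"
    by (rule Bochner_Integration.integral_add[symmetric]) (rule L01.integrable_fst[OF A] L01.integrable_fst[OF B])+
  also have "\<dots> = (\<integral>x. J f 1 * g x \<partial>L01)"
  proof (rule Bochner_Integration.integral_cong[OF refl])
    fix x
    have "(\<integral>t. A x t \<partial>L01) + (\<integral>t. B x t \<partial>L01) = (\<integral>t. A x t + B x t \<partial>L01)"
      by (rule Bochner_Integration.integral_add[symmetric, OF Ai Bi])
    also have "\<dots> = (\<integral>t. f t * g x \<partial>L01)"
    proof (rule integral_cong_AE)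
      show "AE t in L01. A x t + B x t = f t * g x"
        using AE_L01_neq[of x] by eventually_elim (auto simp: A_def B_def)
    qed (use Ai[of x] Bi[of x] L2_measurable[OF f] in auto)
    also have "\<dots> = J f 1 * g x"
      by (simp add: J_1 ip_def)
    finally show "(\<integral>t. A x t \<partial>L01) + (\<integral>t. B x t \<partial>L01) = J f 1 * g x" .
  qed
  also have "\<dots> = J f 1 * J g 1"
    by (simp add: J_1 ip_def)
  finally show ?thesis .
qed

subsection \<open>Antiderivatives adapted to the boundary conditions\<close>

text \<open>The unit interval is cut into \<open>M\<close> half cells of length \<open>1 / M\<close>. Only the parity of \<open>M\<close>
  and of the type \<open>i\<close> matters here: derivatives of order \<open>\<alpha>\<close> vanish at \<open>0\<close> iff \<open>\<alpha> + i\<close> is even,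
  and at \<open>1\<close> iff \<open>\<alpha> + i + M\<close> is even. The paper's types are \<open>i = 0, 1\<close> with even \<open>M\<close> and \<open>i = 2\<close> with
  odd \<open>M\<close>, and differentiation turns type \<open>i\<close> into type \<open>Suc i\<close>.\<close>

definition K :: "nat \<Rightarrow> nat \<Rightarrow> (real \<Rightarrow> real) \<Rightarrow> real \<Rightarrow> real" where
  "K M i f x = J f x -
     (if even i then if even M then x * J f 1 else 0
      else if even M then J (J f) 1 else J f 1)"

lemma K_L2: "f \<in> L2 \<Longrightarrow> K M i f \<in> L2"
  unfolding K_def[abs_def]
  by (rule L2_diff[OF J_L2 L2_continuous_on]; cases "even i"; cases "even M") (auto intro!: continuous_intros)

lemma K_add: "f \<in> L2 \<Longrightarrow> g \<in> L2 \<Longrightarrow> K M i (\<lambda>x. f x + g x) = (\<lambda>x. K M i f x + K M i g x)"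
  using J_add[OF J_L2 J_L2, of f g] ext[OF J_add[of f g], THEN fun_cong]
  by (auto simp: K_def fun_eq_iff J_add distrib_left ext[OF J_add[of f g]])

lemma K_cmult: "K M i (\<lambda>x. c * f x) = (\<lambda>x. c * K M i f x)"
  by (auto simp: K_def ext[OF J_cmult[of c]] algebra_simps)

lemma K_zero: "K M i (\<lambda>_. 0) = (\<lambda>_. 0)"
  using K_cmult[of M i 0 "\<lambda>_. 0"] by simp

lemma K_diff: "f \<in> L2 \<Longrightarrow> g \<in> L2 \<Longrightarrow> K M i (\<lambda>x. f x - g x) x = K M i f x - K M i g x"
  using K_add[OF _ L2_cmult[of g "-1"], of f M i] K_cmult[of M i "-1" g] by simp

text \<open>Integration by parts leaves the boundary term \<open>J f 1 * J g 1\<close>. The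
  corrections built into \<open>K\<close> for the types \<open>i\<close> and \<open>Suc i\<close>
  are matched so that together they cancel it, in each of the four parity cases.\<close>

lemma K_adjoint:
  assumes f: "f \<in> L2" and g: "g \<in> L2"
  shows "ip (K M i f) g = - ip f (K M (Suc i) g)"
proof -
  note fg = ip_J[OF f g]
  have c: "ip (\<lambda>x. h x - c) k = ip h k - c * J k 1" "ip k (\<lambda>x. h x - c) = ip k h - c * J k 1"
    if "h \<in> L2" "k \<in> L2" for h k c
    using that ip_cmult_left[of c "\<lambda>_. 1" k] by (simp_all add: ip_diff_left ip_diff_right J_1 ip_commute)
  have X: "(\<lambda>x. x * c) \<in> L2" for c :: real
    by (intro L2_continuous_on continuous_intros)
  have x: "ip (\<lambda>x. h x - x * c) k = ip h k - c * ip (\<lambda>x. x) k" "ip k (\<lambda>x. h x - x * c) = ip k h - c * ip (\<lambda>x. x) k"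
    if "h \<in> L2" "k \<in> L2" for h k c
    using that X[of c] ip_cmult_left[of c "\<lambda>x. x" k]
    by (simp_all add: ip_diff_left ip_diff_right ip_commute mult.commute)
  \<comment> \<open>Integration by parts against the constant 1, whose antiderivative is
    \<open>x\<close>. It links the correction \<open>x * J f 1\<close> of one type with the mean
    subtracted in the adjoint type.\<close>
  have m: "ip (\<lambda>x. x) h + J (J h) 1 = J h 1" if h: "h \<in> L2" for h
  proof -
    have "ip (J (\<lambda>_. 1)) h = ip (\<lambda>x. x) h"
      unfolding ip_def by (intro Bochner_Integration.integral_cong) (auto simp: J_const)
    then show ?thesis
      using ip_J[of "\<lambda>_. 1" h] h by (simp add: J_const J_1[of "J h"] ip_commute)
  qed
  show ?thesis
    unfolding K_def[abs_def]
    using fg arg_cong[OF m[OF f], of "\<lambda>z. J g 1 * z"] arg_cong[OF m[OF g], of "\<lambda>z. J f 1 * z"]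
      f g J_L2[OF f] J_L2[OF g]
    by (cases "even i"; cases "even M") (simp_all add: c x algebra_simps)
qed

subsection \<open>Midpoint interpolation of antiderivatives\<close>

text \<open>The multiple \<open>j / M\<close> with \<open>j\<close> of the parity of \<open>i\<close> whose cell \<open>[(j - 1) / M, (j + 1) / M)\<close>
  contains \<open>x\<close>.\<close>

definition mid :: "nat \<Rightarrow> nat \<Rightarrow> real \<Rightarrow> real" where
  "mid M i x = (2 * of_int \<lfloor>(real M * x - real i + 1) / 2\<rfloor> + real i) / real M"

lemma mid_bounds:
  assumes "M > 0"
  shows "mid M i x - 1 / M \<le> x" "x < mid M i x + 1 / M"
proof -
  let ?k = "real_of_int \<lfloor>(real M * x - real i + 1) / 2\<rfloor>"
  have "?k \<le> (real M * x - real i + 1) / 2" "(real M * x - real i + 1) / 2 < ?k + 1"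
    by linarith+
  then have "2 * ?k + real i - 1 \<le> x * M" "x * M < 2 * ?k + real i + 1"
    by (simp_all add: algebra_simps)
  then have "(2 * ?k + real i - 1) / M \<le> x" "x < (2 * ?k + real i + 1) / M"
    using assms by (simp_all add: field_simps)
  then show "mid M i x - 1 / M \<le> x" "x < mid M i x + 1 / M"
    by (simp_all add: mid_def add_divide_distrib diff_divide_distrib)
qed

lemma mid_eqI:
  assumes "M > 0" "mid M i x - 1 / M \<le> y" "y < mid M i x + 1 / M"
  shows "mid M i y = mid M i x"
proof -
  let ?k = "\<lfloor>(real M * x - real i + 1) / 2\<rfloor>"
  have "(2 * ?k + real i - 1) / M \<le> y" "y < (2 * ?k + real i + 1) / M"
    using assms(2,3) by (simp_all add: mid_def add_divide_distrib diff_divide_distrib)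
  then have "2 * ?k + real i - 1 \<le> y * M" "y * M < 2 * ?k + real i + 1"
    using assms(1) by (simp_all add: field_simps)
  then have "\<lfloor>(real M * y - real i + 1) / 2\<rfloor> = ?k"
    by (intro floor_unique) (simp_all add: algebra_simps)
  then show ?thesis by (simp add: mid_def)
qed

text \<open>The extreme indices 0 and \<open>M\<close> belong to cells of which only one half lies
  in the unit interval; their midpoints are the endpoints, where the boundary conditions
  act.\<close>

lemma mid_grid:
  fixes x :: real
  assumes "M > 0" "0 < x" "x < 1"
  obtains j :: nat where "j \<le> M" "even (j + i)" "mid M i x = real j / real M"
proof -
  define k where "k = 2 * \<lfloor>(real M * x - real i + 1) / 2\<rfloor> + int i"
  have m: "mid M i x = of_int k / real M"
    by (simp add: mid_def k_def)
  have "of_int k / real M > - 1 / M" "of_int k / real M < (M + 1) / M"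
    using mid_bounds[OF assms(1), where i = i and x = x] assms by (auto simp: m add_divide_distrib)
  then have "real_of_int k > - 1" "real_of_int k < real M + 1"
    using assms(1) by (simp_all only: divide_less_cancel) auto
  then have k: "0 \<le> k" "k \<le> int M" by linarith+
  show thesis
  proof (rule that[of "nat k"])
    show "nat k \<le> M" using k by linarith
    have "even (k + int i)" by (simp add: k_def)
    then show "even (nat k + i)" using k(1)
      by (metis even_nat_iff int_nat_eq nat_int of_nat_add of_nat_0_le_iff even_of_nat)
    show "mid M i x = real (nat k) / real M" using k by (simp add: m)
  qed
qed

lemma mid_measurable: "mid M i \<in> borel_measurable borel"
  unfolding mid_def[abs_def] by measurable

lemma J_clamp: "J f x = J f (max 0 (min x 1))"
  unfolding J_def by (intro Bochner_Integration.integral_cong) auto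

lemma J_borel_measurable:
  assumes "f \<in> L2"
  shows "J f \<in> borel_measurable borel"
proof -
  have "continuous_on UNIV (\<lambda>x. J f (max 0 (min x 1)))"
    by (rule continuous_on_compose2[OF J_continuous[OF assms]]) (auto intro!: continuous_intros)
  then have "continuous_on UNIV (J f)"
    using J_clamp[of f] by simp
  then show ?thesis by (rule borel_measurable_continuous_onI)
qed

lemma J_mid_L2:
  assumes "f \<in> L2"
  shows "(\<lambda>x. J f x - J f (mid M i x)) \<in> L2"
proof -
  have "bounded (J f ` {0..1})"
    using J_continuous[OF assms] compact_Icc compact_continuous_image compact_imp_bounded by blast
  then obtain B where "\<And>x. x \<in> {0..1} \<Longrightarrow> \<bar>J f x\<bar> \<le> B"
    unfolding bounded_iff by fastforce
  then have B: "\<bar>J f x\<bar> \<le> B" for x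
    using J_clamp[of f x] by simp
  have "(\<lambda>x. J f x - J f (mid M i x)) \<in> borel_measurable borel"
    by (intro borel_measurable_diff measurable_compose[OF mid_measurable] J_borel_measurable assms)
  then show ?thesis
  proof (intro L2_bounded borel_measurable_L01)
    show "\<bar>J f x - J f (mid M i x)\<bar> \<le> 2 * B" for x
      using B[of x] B[of "mid M i x"] by linarith
  qed
qed

text \<open>Equality can fail: \<open>P\<close> may select only part of \<open>[a, b]\<close>, and
  for the outermost cells \<open>[a, b]\<close> may stick out of the unit interval.\<close>

lemma nn_integral_L01_le_FTC:
  fixes h H :: "real \<Rightarrow> real"
  assumes "a \<le> b" "h \<in> borel_measurable borel"
    and deriv: "\<And>x. a \<le> x \<Longrightarrow> x \<le> b \<Longrightarrow> (H has_real_derivative h x) (at x)"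
    and nonneg: "\<And>x. a \<le> x \<Longrightarrow> x \<le> b \<Longrightarrow> 0 \<le> h x"
    and P: "\<And>x. P x \<Longrightarrow> a \<le> x \<and> x \<le> b"
  shows "(\<integral>\<^sup>+x. (if P x then ennreal (h x) else 0) \<partial>L01) \<le> ennreal (H b - H a)"
proof -
  have "(\<integral>\<^sup>+x. (if P x then ennreal (h x) else 0) \<partial>L01)
      = (\<integral>\<^sup>+x. (if P x then ennreal (h x) else 0) * indicator {0<..<1} x \<partial>lebesgue)"
    by (subst nn_integral_restrict_space) auto
  also have "\<dots> \<le> (\<integral>\<^sup>+x. ennreal (h x) * indicator {a..b} x \<partial>lebesgue)"
    using P by (intro nn_integral_mono) (auto simp: indicator_def)
  also have "\<dots> = (\<integral>\<^sup>+x. ennreal (h x) * indicator {a..b} x \<partial>lborel)"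
    using assms(2) by (intro nn_integral_completion) measurable
  also have "\<dots> = ennreal (H b - H a)"
    using assms by (intro nn_integral_FTC_Icc) auto
  finally show ?thesis .
qed

lemma nn_integral_square: "f \<in> L2 \<Longrightarrow> (\<integral>\<^sup>+x. ennreal ((f x)\<^sup>2) \<partial>L01) = ennreal (ip f f)"
  unfolding ip_def power2_eq_square[symmetric]
  by (intro nn_integral_eq_integral L2_square_integrable) auto

text \<open>Schur's test for the kernel \<open>k\<close>, with weights given by the extremal function of the one-sided
  Poincare inequality on a half cell.\<close>

lemma midpoint_interpolation:
  assumes M: "M > 0" and f: "f \<in> L2"
  shows "L2_norm (\<lambda>x. J f x - J f (mid M i x)) \<le> 2 / (real M * pi) * L2_norm f"
proof -
  \<comment> \<open>Scaled so that a half cell of length \<open>1 / M\<close> is a quarter period;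
    the bound to be shown is \<open>1 / c\<close>.\<close>
  define c where "c = real M * pi / 2"
  have c: "c > 0" using M by (simp add: c_def)
  have cM: "c * (1 / M) = pi / 2" using M by (simp add: c_def)
  define m where "m = mid M i"
  define w where "w = (\<lambda>x. J f x - J f (m x))"
  \<comment> \<open>\<open>q\<close> is the extremal function, zero at the midpoint like
    \<open>w\<close>; \<open>p\<close> is its derivative up to sign and the factor \<open>c\<close>,
    zero at the outer end of the half cell. Integrating either one against the kernel gives at most
    the other divided by \<open>c\<close>: these are \<open>kp\<close> and
    \<open>kq\<close>.\<close>
  define p where "p = (\<lambda>t. cos (c * (t - m t)))"
  define q where "q = (\<lambda>x. sin (c * \<bar>x - m x\<bar>))"
  \<comment> \<open>The points \<open>t\<close> strictly between the midpoint and \<open>x\<close>,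
    over which \<open>f\<close> integrates to \<open>w x\<close> up to sign.\<close>
  define k where "k = (\<lambda>x t. m x < t \<and> t < x \<or> x < t \<and> t < m x)"
  have mb: "m x - 1 / M \<le> x" "x < m x + 1 / M" for x
    using mid_bounds[OF M] by (auto simp: m_def)
  have kmid: "m t = m x" if "k x t" for x t
    using that mb[of x] unfolding m_def k_def by (intro mid_eqI[OF M]) auto
  have small: "c * \<bar>t - m x\<bar> < pi / 2" "0 < c * \<bar>x - m x\<bar>" "c * \<bar>x - m x\<bar> \<le> pi / 2" if "k x t" for x t
  proof -
    have "\<bar>t - m x\<bar> < 1 / M" "0 < \<bar>x - m x\<bar>" "\<bar>x - m x\<bar> \<le> 1 / M"
      using that mb[of x] unfolding k_def by auto
    then have "c * \<bar>t - m x\<bar> < c * (1 / M)" "0 < c * \<bar>x - m x\<bar>" "c * \<bar>x - m x\<bar> \<le> c * (1 / M)"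
      using c by (blast intro: mult_left_mono mult_strict_left_mono mult_pos_pos less_imp_le)+
    then show "c * \<bar>t - m x\<bar> < pi / 2" "0 < c * \<bar>x - m x\<bar>" "c * \<bar>x - m x\<bar> \<le> pi / 2"
      unfolding cM .
  qed
  have ppos: "p t > 0" if "k x t" for x t
  proof -
    have "cos (c * \<bar>t - m x\<bar>) > 0"
      using small(1)[OF that] c by (intro cos_gt_zero_pi) (auto intro: less_le_trans[of _ 0])
    then show ?thesis
      using kmid[OF that] c by (simp add: p_def abs_if split: if_splits) (metis cos_minus minus_diff_eq mult_minus_right)
  qed
  have qpos: "q x > 0" if "k x t" for x t
    unfolding q_def using small(2,3)[OF that] pi_gt_zero by (intro sin_gt_zero) auto
  have [measurable]: "m \<in> borel_measurable borel" unfolding m_def by (rule mid_measurable)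
  have [measurable]: "J f \<in> borel_measurable borel" by (rule J_borel_measurable[OF f])
  have wL: "w \<in> L2" unfolding w_def m_def by (rule J_mid_L2[OF f])
  have pk: "Measurable.pred (L01 \<Otimes>\<^sub>M L01) (\<lambda>z. k (fst z) (snd z))"
  proof -
    have [measurable]: "(\<lambda>z. fst z) \<in> borel_measurable (L01 \<Otimes>\<^sub>M L01)" "(\<lambda>z. snd z) \<in> borel_measurable (L01 \<Otimes>\<^sub>M L01)"
      by (rule measurable_compose[OF measurable_fst borel_measurable_L01], simp)
         (rule measurable_compose[OF measurable_snd borel_measurable_L01], simp)
    show ?thesis unfolding k_def by measurable
  qed
  have kint: "integrable L01 (\<lambda>t. if k x t then \<bar>f t\<bar> else 0)" for x
  proof -
    have "{t. k x t} = {m x<..<x} \<union> {x<..<m x}" by (auto simp: k_def)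
    then have "{t. k x t} \<in> sets borel" by simp
    from L01_integrable_if[OF integrable_abs[OF L2_integrable[OF f]] this] show ?thesis by simp
  qed
  have wle: "\<bar>w x\<bar> \<le> (\<integral>t. (if k x t then \<bar>f t\<bar> else 0) \<partial>L01)" for x
  proof -
    have eq: "w x = (\<integral>t. (if t \<le> x then f t else 0) - (if t \<le> m x then f t else 0) \<partial>L01)"
      unfolding w_def J_def
      by (rule Bochner_Integration.integral_diff[symmetric]) (rule J_integrable[OF f])+
    have "\<bar>w x\<bar> \<le> (\<integral>t. \<bar>(if t \<le> x then f t else 0) - (if t \<le> m x then f t else 0)\<bar> \<partial>L01)"
      unfolding eq by (rule integral_abs_bound)
    also have "\<dots> = (\<integral>t. (if k x t then \<bar>f t\<bar> else 0) \<partial>L01)"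
    proof (rule integral_cong_AE)
      show "(\<lambda>t. \<bar>(if t \<le> x then f t else 0) - (if t \<le> m x then f t else 0)\<bar>) \<in> borel_measurable L01"
        using J_integrable[OF f, of x] J_integrable[OF f, of "m x"] by auto
      show "(\<lambda>t. if k x t then \<bar>f t\<bar> else 0) \<in> borel_measurable L01"
        using kint[of x] by (rule borel_measurable_integrable)
      show "AE t in L01. \<bar>(if t \<le> x then f t else 0) - (if t \<le> m x then f t else 0)\<bar> = (if k x t then \<bar>f t\<bar> else 0)"
        using AE_L01_neq[of x] AE_L01_neq[of "m x"] by eventually_elim (auto simp: k_def)
    qed
    finally show ?thesis .
  qed
  then have wle': "ennreal \<bar>w x\<bar> \<le> (\<integral>\<^sup>+t. (if k x t then ennreal \<bar>f t\<bar> else 0) \<partial>L01)" for x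
  proof -
    have "(\<integral>\<^sup>+t. (if k x t then ennreal \<bar>f t\<bar> else 0) \<partial>L01) = (\<integral>\<^sup>+t. ennreal (if k x t then \<bar>f t\<bar> else 0) \<partial>L01)"
      by (intro nn_integral_cong) auto
    also have "\<dots> = ennreal (\<integral>t. (if k x t then \<bar>f t\<bar> else 0) \<partial>L01)"
      using kint by (intro nn_integral_eq_integral) auto
    finally show ?thesis using wle[of x] by (simp add: ennreal_leI)
  qed
  have kp: "(\<integral>\<^sup>+t. (if k x t then ennreal (p t) else 0) \<partial>L01) \<le> ennreal (q x / c)" for x
  proof -
    define a b where "a = min x (m x)" and "b = max x (m x)"
    have "(\<integral>\<^sup>+t. (if k x t then ennreal (p t) else 0) \<partial>L01)
        = (\<integral>\<^sup>+t. (if k x t then ennreal (cos (c * (t - m x))) else 0) \<partial>L01)"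
      by (intro nn_integral_cong) (auto simp: p_def kmid)
    also have "\<dots> \<le> ennreal (sin (c * (b - m x)) / c - sin (c * (a - m x)) / c)"
    proof (rule nn_integral_L01_le_FTC[where a = a and b = b and H = "\<lambda>t. sin (c * (t - m x)) / c"])
      fix t assume t: "a \<le> t" "t \<le> b"
      then have "\<bar>t - m x\<bar> \<le> 1 / M"
        using mb[of x] unfolding a_def b_def by linarith
      then have "c * \<bar>t - m x\<bar> \<le> c * (1 / M)"
        using c by (intro mult_left_mono) auto
      then have "\<bar>c * (t - m x)\<bar> \<le> pi / 2"
        using c unfolding cM abs_mult by simp
      then show "0 \<le> cos (c * (t - m x))"
        by (intro cos_ge_zero) auto
      show "((\<lambda>t. sin (c * (t - m x)) / c) has_real_derivative cos (c * (t - m x))) (at t)"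
        using c by (auto intro!: derivative_eq_intros)
    qed (auto simp: a_def b_def k_def)
    also have "sin (c * (b - m x)) / c - sin (c * (a - m x)) / c = q x / c"
    proof (cases "x \<le> m x")
      case True
      then have "c * \<bar>x - m x\<bar> = - (c * (x - m x))" by (simp add: algebra_simps)
      then have "q x = - sin (c * (x - m x))" unfolding q_def by (simp only: sin_minus)
      with True show ?thesis by (simp add: a_def b_def)
    next
      case False
      then show ?thesis by (simp add: a_def b_def q_def)
    qed
    finally show ?thesis .
  qed
  have kq: "(\<integral>\<^sup>+x. (if k x t then ennreal (q x) else 0) \<partial>L01) \<le> ennreal (p t / c)" for t
  proof -
    consider "m t < t" | "t < m t" | "t = m t" by linarith
    then show ?thesis
    proof cases
      case 1
      have qt: "q x = sin (c * (x - m t))" if "k x t" for x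
        using that kmid[OF that] 1 by (auto simp: q_def k_def)
      have "(\<integral>\<^sup>+x. (if k x t then ennreal (q x) else 0) \<partial>L01)
          = (\<integral>\<^sup>+x. (if k x t then ennreal (sin (c * (x - m t))) else 0) \<partial>L01)"
        using 1 by (intro nn_integral_cong) (auto simp: qt)
      also have "\<dots> \<le> ennreal ((- cos (c * (m t + 1 / M - m t)) / c) - (- cos (c * (t - m t)) / c))"
      proof (rule nn_integral_L01_le_FTC[where a = t and b = "m t + 1 / M" and H = "\<lambda>x. - cos (c * (x - m t)) / c"])
        fix x assume x: "t \<le> x" "x \<le> m t + 1 / M"
        then have "c * (x - m t) \<le> c * (1 / M)"
          using c by (intro mult_left_mono) auto
        then show "0 \<le> sin (c * (x - m t))"
          unfolding cM using c 1 x pi_ge_zero by (intro sin_ge_zero mult_nonneg_nonneg) linarith+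
        show "((\<lambda>x. - cos (c * (x - m t)) / c) has_real_derivative sin (c * (x - m t))) (at x)"
          using c by (auto intro!: derivative_eq_intros)
      next
        show "t \<le> x \<and> x \<le> m t + 1 / M" if "k x t" for x
          using that 1 kmid[OF that] mb[of x] unfolding k_def by auto
      qed (use mb[of t] in auto)
      also have "(- cos (c * (m t + 1 / M - m t)) / c) - (- cos (c * (t - m t)) / c) = p t / c"
        unfolding add_diff_cancel_left' cM cos_pi_half by (simp add: p_def)
      finally show ?thesis .
    next
      case 2
      have qt: "q x = sin (c * (m t - x))" if "k x t" for x
        using that kmid[OF that] 2 by (auto simp: q_def k_def)
      have "(\<integral>\<^sup>+x. (if k x t then ennreal (q x) else 0) \<partial>L01)
          = (\<integral>\<^sup>+x. (if k x t then ennreal (sin (c * (m t - x))) else 0) \<partial>L01)"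
        using 2 by (intro nn_integral_cong) (auto simp: qt)
      also have "\<dots> \<le> ennreal (cos (c * (m t - t)) / c - cos (c * (m t - (m t - 1 / M))) / c)"
      proof (rule nn_integral_L01_le_FTC[where a = "m t - 1 / M" and b = t and H = "\<lambda>x. cos (c * (m t - x)) / c"])
        fix x assume x: "m t - 1 / M \<le> x" "x \<le> t"
        then have "c * (m t - x) \<le> c * (1 / M)"
          using c by (intro mult_left_mono) auto
        then show "0 \<le> sin (c * (m t - x))"
          unfolding cM using c 2 x pi_ge_zero by (intro sin_ge_zero mult_nonneg_nonneg) linarith+
        show "((\<lambda>x. cos (c * (m t - x)) / c) has_real_derivative sin (c * (m t - x))) (at x)"
          using c by (auto intro!: derivative_eq_intros)
      next
        show "m t - 1 / M \<le> x \<and> x \<le> t" if "k x t" for x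
          using that 2 kmid[OF that] mb[of x] unfolding k_def by auto
      qed (use mb[of t] in auto)
      also have "cos (c * (m t - t)) / c - cos (c * (m t - (m t - 1 / M))) / c = p t / c"
        unfolding diff_diff_eq2 add_diff_cancel_left' cM cos_pi_half p_def
        using cos_minus[of "c * (t - m t)"] by (simp add: right_diff_distrib)
      finally show ?thesis .
    next
      case 3
      then have "\<not> k x t" for x
        using kmid[of x t] unfolding k_def by auto
      then show ?thesis by simp
    qed
  qed
  \<comment> \<open>The two halves of a weighted arithmetic-geometric mean inequality for
    \<open>\<bar>w x\<bar> * \<bar>f t\<bar>\<close> with ratio \<open>q x / (c * p t)\<close>. With
    this ratio the weights disappear when \<open>A\<close> is integrated over \<open>x\<close> by
    \<open>kq\<close> and \<open>B\<close> over \<open>t\<close> by \<open>kp\<close>.\<close>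
  define A where "A = (\<lambda>x t. ennreal ((f t)\<^sup>2 / (2 * c * p t)) * (if k x t then ennreal (q x) else 0))"
  define B where "B = (\<lambda>x t. ennreal (c * (w x)\<^sup>2 / (2 * q x)) * (if k x t then ennreal (p t) else 0))"
  have [measurable]: "f \<in> borel_measurable L01" by (rule L2_measurable[OF f])
  have [measurable]: "p \<in> borel_measurable L01" "q \<in> borel_measurable L01" "w \<in> borel_measurable L01"
    by (rule borel_measurable_L01, simp add: p_def q_def w_def)+
  have [measurable]: "Measurable.pred (L01 \<Otimes>\<^sub>M L01) (\<lambda>z. k (fst z) (snd z))"
    using pk .
  have "Measurable.pred borel (k x)" "Measurable.pred borel (\<lambda>x. k x t)" for x t
    unfolding k_def by measurable
  then have [measurable]: "Measurable.pred L01 (k x)" "Measurable.pred L01 (\<lambda>x. k x t)" for x t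
    by (auto intro!: measurable_restrict_space1 measurable_completion)
  have Am: "case_prod A \<in> borel_measurable (L01 \<Otimes>\<^sub>M L01)"
    unfolding A_def case_prod_beta' by measurable
  have Bm: "case_prod B \<in> borel_measurable (L01 \<Otimes>\<^sub>M L01)"
    unfolding B_def case_prod_beta' by measurable
  have AB: "ennreal \<bar>w x\<bar> * (if k x t then ennreal \<bar>f t\<bar> else 0) \<le> A x t + B x t" for x t
  proof (cases "k x t")
    case True
    define r where "r = q x / (c * p t)"
    have r: "r > 0" using c ppos[OF True] qpos[OF True] by (simp add: r_def)
    have "0 \<le> (\<bar>f t\<bar> * r - \<bar>w x\<bar>)\<^sup>2 / r" using r by simp
    also have "\<dots> = (f t)\<^sup>2 * r + (w x)\<^sup>2 / r - 2 * (\<bar>w x\<bar> * \<bar>f t\<bar>)"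
      using r by (simp add: power2_diff power_mult_distrib add_divide_distrib diff_divide_distrib power2_eq_square[of r])
    finally have "\<bar>w x\<bar> * \<bar>f t\<bar> \<le> (f t)\<^sup>2 * r / 2 + (w x)\<^sup>2 / r / 2" by simp
    also have "(f t)\<^sup>2 * r / 2 = (f t)\<^sup>2 / (2 * c * p t) * q x"
      by (simp add: r_def)
    also have "(w x)\<^sup>2 / r / 2 = c * (w x)\<^sup>2 / (2 * q x) * p t"
      by (simp add: r_def mult_ac)
    finally have "ennreal (\<bar>w x\<bar> * \<bar>f t\<bar>) \<le> ennreal ((f t)\<^sup>2 / (2 * c * p t) * q x + c * (w x)\<^sup>2 / (2 * q x) * p t)"
      by (rule ennreal_leI)
    also have "\<dots> = A x t + B x t"
      using True c ppos[OF True] qpos[OF True]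
      by (simp add: A_def B_def ennreal_plus flip: ennreal_mult)
    finally show ?thesis using True by (simp add: ennreal_mult)
  qed simp
  \<comment> \<open>The bound on \<open>w\<close> is multiplied by \<open>\<bar>w x\<bar>\<close>
    and integrated. The inner integral runs over \<open>x\<close> for \<open>A\<close> and over
    \<open>t\<close> for \<open>B\<close>. The last term is half of the left side and is absorbed
    afterwards.\<close>
  have key: "ennreal (ip w w) \<le> ennreal (ip f f / (2 * c\<^sup>2)) + ennreal (ip w w / 2)"
  proof -
    have "ennreal (ip w w) = (\<integral>\<^sup>+x. ennreal \<bar>w x\<bar> * ennreal \<bar>w x\<bar> \<partial>L01)"
      by (subst nn_integral_square[OF wL, symmetric]) (simp flip: ennreal_mult add: power2_eq_square)
    also have "\<dots> \<le> (\<integral>\<^sup>+x. ennreal \<bar>w x\<bar> * (\<integral>\<^sup>+t. (if k x t then ennreal \<bar>f t\<bar> else 0) \<partial>L01) \<partial>L01)"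
      by (intro nn_integral_mono mult_left_mono wle') auto
    also have "\<dots> = (\<integral>\<^sup>+x. (\<integral>\<^sup>+t. ennreal \<bar>w x\<bar> * (if k x t then ennreal \<bar>f t\<bar> else 0) \<partial>L01) \<partial>L01)"
      by (intro nn_integral_cong nn_integral_cmult[symmetric]) measurable
    also have "\<dots> \<le> (\<integral>\<^sup>+x. (\<integral>\<^sup>+t. A x t + B x t \<partial>L01) \<partial>L01)"
      by (intro nn_integral_mono AB)
    also have "\<dots> = (\<integral>\<^sup>+x. (\<integral>\<^sup>+t. A x t \<partial>L01) + (\<integral>\<^sup>+t. B x t \<partial>L01) \<partial>L01)"
      using Am Bm by (intro nn_integral_cong nn_integral_add) auto
    also have "\<dots> = (\<integral>\<^sup>+x. (\<integral>\<^sup>+t. A x t \<partial>L01) \<partial>L01) + (\<integral>\<^sup>+x. (\<integral>\<^sup>+t. B x t \<partial>L01) \<partial>L01)"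
      using Am Bm by (intro nn_integral_add L01.borel_measurable_nn_integral_fst) auto
    also have "(\<integral>\<^sup>+x. (\<integral>\<^sup>+t. A x t \<partial>L01) \<partial>L01) = (\<integral>\<^sup>+t. (\<integral>\<^sup>+x. A x t \<partial>L01) \<partial>L01)"
      by (rule L01.Fubini'[OF Am, symmetric])
    also have "\<dots> \<le> (\<integral>\<^sup>+t. ennreal (1 / (2 * c\<^sup>2)) * ennreal ((f t)\<^sup>2) \<partial>L01)"
    proof (rule nn_integral_mono)
      fix t
      have "(\<integral>\<^sup>+x. A x t \<partial>L01) = ennreal ((f t)\<^sup>2 / (2 * c * p t)) * (\<integral>\<^sup>+x. (if k x t then ennreal (q x) else 0) \<partial>L01)"
        unfolding A_def by (rule nn_integral_cmult) measurable
      also have "\<dots> \<le> ennreal ((f t)\<^sup>2 / (2 * c * p t)) * ennreal (p t / c)"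
        by (intro mult_left_mono kq) auto
      also have "\<dots> \<le> ennreal (1 / (2 * c\<^sup>2) * (f t)\<^sup>2)"
      proof (cases "p t > 0")
        case True
        then show ?thesis
          using c by (subst ennreal_mult[symmetric]) (auto simp: power2_eq_square[of c])
      next
        case False
        \<comment> \<open>Where \<open>p t\<close> is not positive the quotient in \<open>A\<close>
          carries no information, but the factor supplied by \<open>kq\<close> vanishes.\<close>
        then have "ennreal (p t / c) = 0" using c by (intro ennreal_neg divide_nonpos_pos) auto
        then show ?thesis by simp
      qed
      finally show "(\<integral>\<^sup>+x. A x t \<partial>L01) \<le> ennreal (1 / (2 * c\<^sup>2)) * ennreal ((f t)\<^sup>2)"
        by (subst (asm) ennreal_mult'') simp_all
    qed
    also have "\<dots> = ennreal (1 / (2 * c\<^sup>2)) * ennreal (ip f f)"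
      by (subst nn_integral_cmult) (auto simp: nn_integral_square[OF f])
    also have "\<dots> = ennreal (ip f f / (2 * c\<^sup>2))"
      by (subst ennreal_mult[symmetric]) (auto simp: ip_self_nonneg)
    also have "(\<integral>\<^sup>+x. (\<integral>\<^sup>+t. B x t \<partial>L01) \<partial>L01) \<le> (\<integral>\<^sup>+x. ennreal (1 / 2) * ennreal ((w x)\<^sup>2) \<partial>L01)"
    proof (rule nn_integral_mono)
      fix x
      have "(\<integral>\<^sup>+t. B x t \<partial>L01) = ennreal (c * (w x)\<^sup>2 / (2 * q x)) * (\<integral>\<^sup>+t. (if k x t then ennreal (p t) else 0) \<partial>L01)"
        unfolding B_def by (rule nn_integral_cmult) measurable
      also have "\<dots> \<le> ennreal (c * (w x)\<^sup>2 / (2 * q x)) * ennreal (q x / c)"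
        by (intro mult_left_mono kp) auto
      also have "\<dots> \<le> ennreal (1 / 2 * (w x)\<^sup>2)"
      proof (cases "q x > 0")
        case True
        then show ?thesis
          using c by (subst ennreal_mult[symmetric]) auto
      next
        case False
        then have "ennreal (q x / c) = 0" using c by (intro ennreal_neg divide_nonpos_pos) auto
        then show ?thesis by simp
      qed
      finally show "(\<integral>\<^sup>+t. B x t \<partial>L01) \<le> ennreal (1 / 2) * ennreal ((w x)\<^sup>2)"
        by (subst (asm) ennreal_mult'') simp_all
    qed
    also have "\<dots> = ennreal (1 / 2) * ennreal (ip w w)"
      by (subst nn_integral_cmult) (auto simp: nn_integral_square[OF wL])
    also have "\<dots> = ennreal (ip w w / 2)"
      by (subst ennreal_mult[symmetric]) (auto simp: ip_self_nonneg)
    finally show ?thesis by (simp add: add_left_mono)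
  qed
  then have "ip w w \<le> ip f f / (2 * c\<^sup>2) + ip w w / 2"
    using ip_self_nonneg[of w] ip_self_nonneg[of f] by (simp flip: ennreal_plus)
  then have "ip w w \<le> ip f f / c\<^sup>2" by simp
  then have "L2_norm w \<le> sqrt (ip f f / c\<^sup>2)"
    by (simp add: L2_norm_eq)
  also have "\<dots> = 2 / (real M * pi) * L2_norm f"
    using c by (simp add: L2_norm_eq real_sqrt_divide c_def)
  finally show ?thesis by (simp add: w_def m_def)
qed

subsection \<open>The spline spaces as iterated antiderivatives\<close>

definition cell :: "nat \<Rightarrow> nat \<Rightarrow> real \<Rightarrow> real" where
  "cell M j = indicator {(real j - 1) / real M..<(real j + 1) / real M}"

text \<open>Spline spaces are built by integration, which makes smoothness and boundary conditions
  automatic. Leaving out the cells around 0 and 1 in degree 0 is the condition of order 0 there.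
  With odd \<open>i\<close> and even \<open>M\<close> no end value is prescribed while
  \<open>K\<close> yields only functions of mean zero, so the constant is added.\<close>

fun gens :: "nat \<Rightarrow> nat \<Rightarrow> nat \<Rightarrow> (real \<Rightarrow> real) set" where
  "gens M 0 i = cell M ` {j. 0 < j \<and> j < M \<and> even (j + i)} \<union> (if odd i \<and> even M then {\<lambda>_. 1} else {})"
| "gens M (Suc p) i = K M i ` gens M p (Suc i) \<union> (if odd i \<and> even M then {\<lambda>_. 1} else {})"

definition sp :: "nat \<Rightarrow> nat \<Rightarrow> nat \<Rightarrow> (real \<Rightarrow> real) set" where
  "sp M p i = lspan (gens M p i)"

lemma finite_gens: "finite (gens M p i)"
  by (induction p arbitrary: i) auto

lemma cell_L2: "cell M j \<in> L2"
proof (rule L2_bounded[where B = 1])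
  show "cell M j \<in> borel_measurable L01"
    unfolding cell_def by (rule borel_measurable_L01) simp
qed (auto simp: cell_def indicator_def)

lemma gens_L2: "gens M p i \<subseteq> L2"
  by (induction p arbitrary: i) (auto simp: cell_L2 K_L2 subset_iff)

lemma sp_L2: "sp M p i \<subseteq> L2"
  using lspan_L2[OF _ gens_L2] by (auto simp: sp_def)

lemma sp_const:
  assumes "odd i" "even M"
  shows "(\<lambda>_. c) \<in> sp M p i"
proof -
  have "(\<lambda>_. 1) \<in> gens M p i" using assms by (cases p) auto
  from lspan_base[OF this, of c] show ?thesis by (simp add: sp_def)
qed

lemma sp_Suc:
  assumes "s \<in> sp M p (Suc i)" "c \<noteq> 0 \<Longrightarrow> odd i \<and> even M"
  shows "(\<lambda>x. c + K M i s x) \<in> sp M (Suc p) i"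
  using assms(1) unfolding sp_def
proof (induction rule: lspan.induct)
  case zero
  show ?case
    using assms(2) sp_const[of i M c "Suc p"] lspan.zero by (cases "c = 0") (auto simp: K_zero sp_def)
next
  case (step b s a)
  have "b \<in> L2" "s \<in> L2" using step(1,2) gens_L2 lspan_L2[OF _ gens_L2] by auto
  then have "K M i (\<lambda>x. a * b x + s x) = (\<lambda>x. a * K M i b x + K M i s x)"
    by (simp add: K_add L2_cmult K_cmult)
  moreover have "(\<lambda>x. a * K M i b x + (c + K M i s x)) \<in> lspan (gens M (Suc p) i)"
    using step by (intro lspan.step) auto
  ultimately show ?case by (simp add: add.left_commute)
qed

lemma sp_SucE:
  assumes "s \<in> sp M (Suc p) i"
  shows "\<exists>c. \<exists>t\<in>sp M p (Suc i). (c \<noteq> 0 \<longrightarrow> odd i \<and> even M) \<and> s = (\<lambda>x. c + K M i t x)"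
  using assms unfolding sp_def
proof (induction rule: lspan.induct)
  case zero
  show ?case
    by (intro exI[of _ 0] bexI[of _ "\<lambda>_. 0"]) (auto simp: K_zero lspan.zero)
next
  case (step b s a)
  then obtain c t where t: "t \<in> lspan (gens M p (Suc i))" "c \<noteq> 0 \<longrightarrow> odd i \<and> even M"
    "s = (\<lambda>x. c + K M i t x)" by blast
  have tL: "t \<in> L2" using t(1) lspan_L2[OF _ gens_L2] by auto
  from step(1) consider g where "g \<in> gens M p (Suc i)" "b = K M i g"
    | "odd i" "even M" "b = (\<lambda>_. 1)"
    by (auto split: if_splits)
  then show ?case
  proof cases
    case 1
    have gL: "g \<in> L2" using 1 gens_L2 by auto
    have "K M i (\<lambda>x. a * g x + t x) = (\<lambda>x. a * K M i g x + K M i t x)"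
      using tL gL by (simp add: K_add L2_cmult K_cmult)
    then show ?thesis
      using 1 t by (intro exI[of _ c] bexI[of _ "\<lambda>x. a * g x + t x"]) (auto intro: lspan.step)
  next
    case 2
    then show ?thesis
      using t by (intro exI[of _ "a + c"] bexI[of _ t]) auto
  qed
qed

text \<open>Up to the constants allowed by the type, \<open>K M i\<close> is exactly the antiderivative with the
  boundary values of type \<open>i\<close>.\<close>

lemma K_form:
  assumes "f \<in> L2"
  obtains c g where "g \<in> L2" "L2_norm g \<le> L2_norm f" "even i \<Longrightarrow> c = 0" "even (i + M) \<Longrightarrow> c + J g 1 = 0"
    "\<And>x. x \<in> {0..1} \<Longrightarrow> K M i f x = c + J g x"
proof (cases "even i \<and> even M")
  case True
  have J: "J (\<lambda>x. f x - J f 1) x = J f x - J f 1 * x" if "x \<in> {0..1}" for x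
    using J_diff[OF assms L2_const] J_const[OF that] by simp
  show thesis
  proof (rule that[of "\<lambda>x. f x - J f 1" 0])
    show "L2_norm (\<lambda>x. f x - J f 1) \<le> L2_norm f"
      using L2_norm_mean_le[OF assms] by (simp add: J_1)
  qed (use True assms in \<open>auto simp: J K_def\<close>)
next
  case False
  show thesis
    by (rule that[of f "- (if even i then 0 else if even M then J (J f) 1 else J f 1)"])
       (use False assms in \<open>auto simp: K_def\<close>)
qed

text \<open>Prescribed values determine the constant of integration; at both ends they also force
  \<open>J g 1 = 0\<close>, so that the correction in \<open>K\<close> drops out. A free constant
  survives only if no end value is prescribed.\<close>

lemma form_K:
  assumes "even i \<Longrightarrow> c = 0" "even (i + M) \<Longrightarrow> c + J g 1 = 0"
  obtains d where "d \<noteq> 0 \<Longrightarrow> odd i \<and> even M" "\<And>x. c + J g x = d + K M i g x"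
proof (cases "odd i \<and> even M")
  case True
  then show thesis by (intro that[of "c + J (J g) 1"]) (auto simp: K_def)
next
  case False
  then show thesis using assms by (intro that[of 0]) (auto simp: K_def)
qed

section \<open>Best approximation by splines in every degree\<close>

lemma sp_projection:
  assumes "f \<in> L2"
  shows "\<exists>s\<in>sp M p i. (\<forall>t\<in>sp M p i. ip (\<lambda>x. f x - s x) t = 0) \<and>
    (\<forall>t\<in>sp M p i. L2_norm (\<lambda>x. f x - s x) \<le> L2_norm (\<lambda>x. f x - t x))"
proof -
  obtain s where s: "s \<in> sp M p i" "\<And>b. b \<in> gens M p i \<Longrightarrow> ip (\<lambda>x. f x - s x) b = 0"
    using orthogonal_projection[OF finite_gens gens_L2 assms, of M p i] by (auto simp: sp_def)
  have sL: "s \<in> L2" using s(1) sp_L2 by auto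
  have orth: "ip (\<lambda>x. f x - s x) t = 0" if "t \<in> sp M p i" for t
    using lspan_orthogonal[OF _ gens_L2 L2_diff[OF assms sL] s(2)] that by (auto simp: sp_def)
  have "L2_norm (\<lambda>x. f x - s x) \<le> L2_norm (\<lambda>x. f x - t x)" if t: "t \<in> sp M p i" for t
  proof -
    define e where "e = (\<lambda>x. f x - s x)"
    define d where "d = (\<lambda>x. s x + (-1) * t x)"
    have "d \<in> sp M p i"
      using s(1) t unfolding d_def sp_def by (intro lspan_add lspan_cmult)
    then have "d \<in> L2" "ip e d = 0" using sp_L2 orth by (auto simp: e_def)
    moreover have "e \<in> L2" unfolding e_def by (rule L2_diff[OF assms sL])
    ultimately have "ip (\<lambda>x. e x + d x) (\<lambda>x. e x + d x) = ip e e + ip d d"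
      by (simp add: ip_linear L2_add ip_commute[of d e])
    moreover have "(\<lambda>x. e x + d x) = (\<lambda>x. f x - t x)" by (auto simp: e_def d_def)
    ultimately have "ip e e \<le> ip (\<lambda>x. f x - t x) (\<lambda>x. f x - t x)"
      using ip_self_nonneg[of d] by simp
    then show ?thesis by (simp add: L2_norm_eq e_def)
  qed
  then show ?thesis using s(1) orth by blast
qed

text \<open>Cells whose indices share the parity of \<open>i\<close> tile the line: two such indices
  differ by an even number, so cells meeting in \<open>x\<close> have the same index.\<close>

lemma cell_eq:
  assumes M: "M > 0" and j: "even (j + i)" and x: "0 < x" "x < 1"
  shows "cell M j x = (if mid M i x = real j / real M then 1 else 0)"
proof -
  obtain l where l: "even (l + i)" "mid M i x = real l / real M"
    using mid_grid[OF M x] by metis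
  have "(real l - 1) / M \<le> x" "x < (real l + 1) / M"
    using mid_bounds[OF M, where i = i and x = x] unfolding l(2) by (auto simp: diff_divide_distrib add_divide_distrib)
  then have b: "real l - 1 \<le> x * M" "x * M < real l + 1"
    using M by (auto simp: field_simps)
  have "(real j - 1) / M \<le> x \<and> x < (real j + 1) / M \<longleftrightarrow> real j - 1 \<le> x * M \<and> x * M < real j + 1"
    using M by (auto simp: field_simps)
  also have "\<dots> \<longleftrightarrow> j = l"
  proof
    assume "real j - 1 \<le> x * M \<and> x * M < real j + 1"
    then have "j < l + 2" "l < j + 2" using b by linarith+
    moreover have "even (j + l)" using j l(1) by presburger
    ultimately show "j = l" by presburger
  qed (use b in auto)
  finally show ?thesis
    using M l(2) by (auto simp: cell_def indicator_def)
qed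

text \<open>The approximant takes on each cell the value of \<open>K M i f\<close> at the midpoint.
  On a half cell at an end of the interval it is 0 by construction, and this is again the midpoint
  value, because type \<open>i\<close> prescribes the value 0 exactly at those ends that are
  midpoints.\<close>

lemma approx_base:
  assumes M: "M > 0" and f: "f \<in> L2"
  shows "\<exists>s\<in>sp M 0 i. L2_norm (\<lambda>x. K M i f x - s x) \<le> 2 / (real M * pi) * L2_norm f"
proof -
  obtain c g where g: "g \<in> L2" "L2_norm g \<le> L2_norm f" "even i \<Longrightarrow> c = 0" "even (i + M) \<Longrightarrow> c + J g 1 = 0"
    "\<And>x. x \<in> {0..1} \<Longrightarrow> K M i f x = c + J g x"
    using K_form[OF f, of i M] by blast
  define A where "A = {j. 0 < j \<and> j < M \<and> even (j + i)}"
  define s where "s = (\<lambda>x. \<Sum>j\<in>A. (c + J g (real j / real M)) * cell M j x)"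
  have sp: "s \<in> sp M 0 i"
    unfolding s_def sp_def by (rule lspan_sum) (auto simp: A_def)
  have "s x = c + J g (mid M i x)" if x: "0 < x" "x < 1" for x
  proof -
    obtain l where l: "l \<le> M" "even (l + i)" "mid M i x = real l / real M"
      using mid_grid[OF M x] by metis
    have fA: "finite A" by (simp add: A_def)
    have "s x = (\<Sum>j\<in>A. if j = l then c + J g (real l / real M) else 0)"
      unfolding s_def using M cell_eq[OF M _ x, of _ i] by (intro sum.cong) (auto simp: A_def l(3))
    also have "\<dots> = (if l \<in> A then c + J g (real l / real M) else 0)"
      using fA by simp
    also have "\<dots> = c + J g (real l / real M)"
    proof (cases "l \<in> A")
      case False
      then consider "l = 0" | "l = M" using l(1,2) by (auto simp: A_def)
      then show ?thesis
        using g(3,4) l(2) M False by cases (auto simp: add.commute)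
    qed simp
    finally show ?thesis using l(3) by simp
  qed
  then have "L2_norm (\<lambda>x. K M i f x - s x) = L2_norm (\<lambda>x. J g x - J g (mid M i x))"
    using g(5) by (intro L2_norm_cong) auto
  then have "L2_norm (\<lambda>x. K M i f x - s x) \<le> 2 / (real M * pi) * L2_norm g"
    using midpoint_interpolation[OF M g(1), of i] by simp
  also have "\<dots> \<le> 2 / (real M * pi) * L2_norm f"
    using g(2) by (intro mult_left_mono) auto
  finally show ?thesis using sp by blast
qed

text \<open>The type has to stay arbitrary in the induction: duality for \<open>K M i\<close> on
  splines of type \<open>Suc i\<close> calls the hypothesis for the adjoint
  \<open>K M (Suc i)\<close>. The constant does not deteriorate because the projection residual is
  no larger than \<open>f\<close>.\<close>

lemma approx_K:
  assumes M: "M > 0" and f: "f \<in> L2"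
  shows "\<exists>s\<in>sp M p i. L2_norm (\<lambda>x. K M i f x - s x) \<le> 2 / (real M * pi) * L2_norm f"
  using f
proof (induction p arbitrary: i f)
  case 0
  then show ?case by (rule approx_base[OF M])
next
  case (Suc p)
  obtain s where s: "s \<in> sp M p (Suc i)" "\<And>t. t \<in> sp M p (Suc i) \<Longrightarrow> ip (\<lambda>x. f x - s x) t = 0"
    "\<And>t. t \<in> sp M p (Suc i) \<Longrightarrow> L2_norm (\<lambda>x. f x - s x) \<le> L2_norm (\<lambda>x. f x - t x)"
    using sp_projection[OF Suc.prems] by metis
  have sL: "s \<in> L2" using s(1) sp_L2 by auto
  let ?e = "\<lambda>x. f x - s x"
  have eL: "?e \<in> L2" by (rule L2_diff[OF Suc.prems sL])
  have "L2_norm (K M i ?e) \<le> 2 / (real M * pi) * L2_norm ?e"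
    by (rule duality_bound[where K' = "K M (Suc i)" and S = "sp M p (Suc i)"])
       (use K_adjoint K_L2 eL Suc.IH sp_L2 s(2) in auto)
  also have "\<dots> \<le> 2 / (real M * pi) * L2_norm f"
    using s(3)[of "\<lambda>_. 0"] lspan.zero by (intro mult_left_mono) (auto simp: sp_def)
  finally have "L2_norm (\<lambda>x. K M i f x - K M i s x) \<le> 2 / (real M * pi) * L2_norm f"
    unfolding ext[OF K_diff[OF Suc.prems sL]] .
  then show ?case
    using sp_Suc[OF s(1), of 0] by (intro bexI[of _ "\<lambda>x. 0 + K M i s x"]) auto
qed

text \<open>Duality acts on the residual \<open>f\<close> of the best approximation to the
  derivative \<open>v1\<close>, which is at least as good as the competitor \<open>t\<close>.
  Returning the error as \<open>K M i f\<close> lets its norm and that of its derivative be read off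
  together.\<close>

lemma chain_step:
  assumes M: "M > 0" and v: "v0 \<in> L2" "v1 \<in> L2" "AE x in L01. v0 x = c + J v1 x"
    and c: "even i \<Longrightarrow> c = 0" "even (i + M) \<Longrightarrow> c + J v1 1 = 0"
    and t: "t \<in> sp M p (Suc i)" "L2_norm (\<lambda>x. v1 x - t x) \<le> B"
  shows "\<exists>R\<in>sp M (Suc p) i. \<exists>f\<in>L2. L2_norm f \<le> B \<and> L2_norm (K M i f) \<le> 2 / (real M * pi) * B \<and>
    (AE x in L01. v0 x - R x = K M i f x)"
proof -
  obtain s where s: "s \<in> sp M p (Suc i)" "\<And>t. t \<in> sp M p (Suc i) \<Longrightarrow> ip (\<lambda>x. v1 x - s x) t = 0"
    "\<And>t. t \<in> sp M p (Suc i) \<Longrightarrow> L2_norm (\<lambda>x. v1 x - s x) \<le> L2_norm (\<lambda>x. v1 x - t x)"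
    using sp_projection[OF v(2)] by metis
  have sL: "s \<in> L2" using s(1) sp_L2 by auto
  let ?e = "\<lambda>x. v1 x - s x"
  have eL: "?e \<in> L2" by (rule L2_diff[OF v(2) sL])
  have e: "L2_norm ?e \<le> B" using s(3)[OF t(1)] t(2) by simp
  have "L2_norm (K M i ?e) \<le> 2 / (real M * pi) * L2_norm ?e"
    by (rule duality_bound[where K' = "K M (Suc i)" and S = "sp M p (Suc i)"])
       (use K_adjoint K_L2 eL approx_K[OF M] sp_L2 s(2) in auto)
  also have "\<dots> \<le> 2 / (real M * pi) * B"
    using e by (intro mult_left_mono) auto
  finally have Ke: "L2_norm (K M i ?e) \<le> 2 / (real M * pi) * B" .
  obtain d where d: "d \<noteq> 0 \<Longrightarrow> odd i \<and> even M" "\<And>x. c + J v1 x = d + K M i v1 x"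
    using form_K[of i c M v1] c by metis
  have "AE x in L01. v0 x - (d + K M i s x) = K M i ?e x"
    using v(3) by eventually_elim (simp add: d(2) K_diff[OF v(2) sL])
  moreover have "(\<lambda>x. d + K M i s x) \<in> sp M (Suc p) i"
    using s(1) d(1) by (rule sp_Suc)
  ultimately show ?thesis using eL e Ke
    by (intro bexI[of _ "\<lambda>x. d + K M i s x"] bexI[of _ ?e] conjI)
qed

text \<open>Here \<open>v k\<close> plays the k-th derivative and \<open>c k\<close> its value at 0.
  Each Ritz step uses up one derivative and one degree; in degree 0 midpoint interpolation still
  gains one factor, which explains \<open>r \<le> Suc p\<close>.\<close>

lemma chain_approx:
  assumes M: "M > 0" and "\<And>k. k \<le> r \<Longrightarrow> v k \<in> L2"
    and "\<And>k. k < r \<Longrightarrow> AE x in L01. v k x = c k + J (v (Suc k)) x"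
    and "\<And>k. k < r \<Longrightarrow> even (k + i) \<Longrightarrow> c k = 0"
    and "\<And>k. k < r \<Longrightarrow> even (k + i + M) \<Longrightarrow> c k + J (v (Suc k)) 1 = 0"
    and "r \<le> Suc p"
  shows "\<exists>s\<in>sp M p i. L2_norm (\<lambda>x. v 0 x - s x) \<le> (2 / (real M * pi)) ^ r * L2_norm (v r)"
  using assms(2-)
proof (induction r arbitrary: v c i p)
  case 0
  then show ?case using lspan.zero by (intro bexI[of _ "\<lambda>_. 0"]) (auto simp: sp_def)
next
  case (Suc r)
  let ?l = "2 / (real M * pi)"
  note ae0 = Suc.prems(2)[of 0]
  show ?case
  proof (cases p)
    \<comment> \<open>No lower degree is available for a Ritz step, but only one derivative is left,
      and \<open>v 0\<close> is \<open>K M i (v 1)\<close> up to a constant that lies in the spline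
      space.\<close>
    case 0
    then have r: "r = 0" using Suc.prems(5) by simp
    obtain d where d: "d \<noteq> 0 \<Longrightarrow> odd i \<and> even M" "\<And>x. c 0 + J (v 1) x = d + K M i (v 1) x"
      using form_K[of i "c 0" M "v 1"] Suc.prems(3,4)[of 0] by auto
    have v1: "v 1 \<in> L2" using Suc.prems(1) r by auto
    obtain s where s: "s \<in> sp M 0 i" "L2_norm (\<lambda>x. K M i (v 1) x - s x) \<le> ?l * L2_norm (v 1)"
      using approx_K[OF M v1] by metis
    have sL: "s \<in> L2" using s(1) sp_L2 by auto
    have ds: "(\<lambda>x. d + s x) \<in> sp M 0 i"
    proof (cases "d = 0")
      case False
      then show ?thesis using sp_const[of i M d 0] d(1) s(1) unfolding sp_def by (intro lspan_add) auto
    qed (use s(1) in simp)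
    have "AE x in L01. K M i (v 1) x - s x = v 0 x - (d + s x)"
      using ae0 by simp (auto elim!: eventually_mono simp: d(2)[simplified])
    then have "L2_norm (\<lambda>x. v 0 x - (d + s x)) = L2_norm (\<lambda>x. K M i (v 1) x - s x)"
      using K_L2[OF v1] sL by (intro L2_norm_cong_AE[symmetric] L2_diff) auto
    then show ?thesis using s(2) ds r 0 by (intro bexI[of _ "\<lambda>x. d + s x"]) auto
  next
    case (Suc q)
    have "\<exists>s\<in>sp M q (Suc i). L2_norm (\<lambda>x. v (Suc 0) x - s x) \<le> ?l ^ r * L2_norm (v (Suc r))"
    proof (rule Suc.IH[of "\<lambda>k. v (Suc k)" "\<lambda>k. c (Suc k)" "Suc i" q])
      show "v (Suc k) \<in> L2" if "k \<le> r" for k using Suc.prems(1) that by simp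
      show "AE x in L01. v (Suc k) x = c (Suc k) + J (v (Suc (Suc k))) x" if "k < r" for k
        using Suc.prems(2) that by simp
      show "c (Suc k) = 0" if "k < r" "even (k + Suc i)" for k
        using Suc.prems(3)[of "Suc k"] that by simp
      show "c (Suc k) + J (v (Suc (Suc k))) 1 = 0" if "k < r" "even (k + Suc i + M)" for k
        using Suc.prems(4)[of "Suc k"] that by simp
      show "r \<le> Suc q" using Suc.prems(5) Suc by simp
    qed
    then obtain t where t: "t \<in> sp M q (Suc i)" "L2_norm (\<lambda>x. v 1 x - t x) \<le> ?l ^ r * L2_norm (v (Suc r))"
      by auto
    have "v 0 \<in> L2" "v 1 \<in> L2" "AE x in L01. v 0 x = c 0 + J (v 1) x" "even i \<Longrightarrow> c 0 = 0"
      "even (i + M) \<Longrightarrow> c 0 + J (v 1) 1 = 0"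
      using Suc.prems(1)[of 0] Suc.prems(1)[of 1] ae0 Suc.prems(3,4)[of 0] by auto
    from chain_step[OF M this t] obtain R f where R: "R \<in> sp M (Suc q) i" "f \<in> L2"
      "L2_norm (K M i f) \<le> ?l * (?l ^ r * L2_norm (v (Suc r)))" "AE x in L01. v 0 x - R x = K M i f x"
      by blast
    have "L2_norm (K M i f) = L2_norm (\<lambda>x. v 0 x - R x)"
      using R(4) K_L2[OF R(2)] by (intro L2_norm_cong_AE) (auto elim: eventually_mono)
    then show ?thesis using R(1,3) Suc by (intro bexI[of _ R]) (auto simp: mult.assoc)
  qed
qed

subsection \<open>Membership in the spline spaces with boundary conditions\<close>

text \<open>Passing from \<open>K\<close> back to \<open>J\<close> exhibits the derivative
  \<open>t\<close>. For zero values at both ends the mean has to be removed from the integrand,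
  which stays a spline because constants belong to type \<open>Suc i\<close> in that case.\<close>

lemma sp_antiderivative:
  assumes "s \<in> sp M (Suc p) i"
  obtains c t where "t \<in> sp M p (Suc i)" "even i \<Longrightarrow> c = 0" "even (i + M) \<Longrightarrow> c + J t 1 = 0"
    "\<And>x. x \<in> {0..1} \<Longrightarrow> s x = c + J t x"
proof -
  obtain c t where t: "t \<in> sp M p (Suc i)" "c \<noteq> 0 \<longrightarrow> odd i \<and> even M" "s = (\<lambda>x. c + K M i t x)"
    using sp_SucE[OF assms] by blast
  have tL: "t \<in> L2" using t(1) sp_L2 by auto
  show thesis
  proof (cases "even i \<and> even M")
    case True
    define g where "g = (\<lambda>x. t x + - J t 1)"
    have "J (\<lambda>x. t x - J t 1) x = J t x - J t 1 * x" if "x \<in> {0..1}" for x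
      using J_diff[OF tL L2_const] J_const[OF that] by simp
    then have J: "J g x = J t x - J t 1 * x" if "x \<in> {0..1}" for x
      using that by (simp add: g_def)
    have "g \<in> sp M p (Suc i)"
      using t(1) sp_const[of "Suc i" M "- J t 1" p] True unfolding g_def sp_def by (intro lspan_add) auto
    then show thesis
      by (rule that[of g 0]) (use True t in \<open>auto simp: J K_def\<close>)
  next
    case False
    show thesis
      by (rule that[of t "c - (if even i then 0 else if even M then J (J t) 1 else J t 1)"])
         (use False t in \<open>auto simp: K_def\<close>)
  qed
qed

text \<open>After \<open>p\<close> integrations the value 0 on the half cells at the ends becomes
  the one-sided boundary condition of highest order \<open>p\<close>.\<close>

lemma sp_base_const:
  assumes M: "M > 0" and s: "s \<in> sp M 0 i" and j: "j \<le> M" "even (j + i)"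
  obtains a where "\<And>x. 0 < x \<Longrightarrow> x < 1 \<Longrightarrow> \<bar>x - real j / M\<bar> < 1 / M \<Longrightarrow> s x = a" "j = 0 \<or> j = M \<Longrightarrow> a = 0"
proof -
  have "\<exists>a. (\<forall>x. 0 < x \<and> x < 1 \<and> \<bar>x - real j / M\<bar> < 1 / M \<longrightarrow> s x = a) \<and> (j = 0 \<or> j = M \<longrightarrow> a = 0)"
    using s unfolding sp_def
  proof (induction rule: lspan.induct)
    case zero
    then show ?case by blast
  next
    case (step b s a)
    then obtain d where d: "\<And>x. 0 < x \<and> x < 1 \<and> \<bar>x - real j / M\<bar> < 1 / M \<Longrightarrow> s x = d" "j = 0 \<or> j = M \<longrightarrow> d = 0"
      by blast
    from step(1) consider l where "0 < l" "l < M" "even (l + i)" "b = cell M l"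
      | "odd i" "even M" "b = (\<lambda>_. 1)"
      by (auto split: if_splits)
    then show ?case
    proof cases
      case 1
      have "b x = (if j = l then 1 else 0)" if x: "0 < x" "x < 1" "\<bar>x - real j / M\<bar> < 1 / M" for x
      proof -
        have "cell M j x = 1"
          using x(3) unfolding cell_def diff_divide_distrib add_divide_distrib by (simp add: abs_less_iff indicator_def)
        then have "mid M i x = real j / real M"
          using cell_eq[OF M j(2) x(1,2)] by (simp split: if_splits)
        then show ?thesis
          using cell_eq[OF M 1(3) x(1,2)] M by (simp add: 1(4))
      qed
      then show ?thesis
        using d 1 by (intro exI[of _ "a * (if j = l then 1 else 0) + d"]) auto
    next
      \<comment> \<open>Here \<open>j\<close> is odd and \<open>M\<close> is even, so
        \<open>j\<close> is neither 0 nor \<open>M\<close>.\<close>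
      case 2
      then show ?thesis
        using d j M by (intro exI[of _ "a + d"]) auto
    qed
  qed
  then show thesis using that by blast
qed

section \<open>Polynomial pieces of the splines\<close>

lemma poly_antiderivative:
  fixes q :: "real poly"
  obtains Q where "pderiv Q = q" "degree Q \<le> Suc (degree q)"
proof
  define Q where "Q = (\<Sum>k\<le>degree q. monom (coeff q k / real (Suc k)) (Suc k))"
  have "pderiv Q = (\<Sum>k\<le>degree q. monom (coeff q k) k)"
    unfolding Q_def higher_pderiv_sum[of 1, simplified] pderiv_monom by (intro sum.cong) auto
  also have "\<dots> = q" by (rule poly_as_sum_of_monoms)
  finally show "pderiv Q = q" .
  show "degree Q \<le> Suc (degree q)"
    unfolding Q_def by (intro degree_sum_le) (auto intro: order_trans[OF degree_monom_le])
qed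

lemma J_constant_on:
  assumes "f \<in> L2" "0 \<le> a" "a \<le> b" "b \<le> 1" "\<And>x. a < x \<Longrightarrow> x < b \<Longrightarrow> f x = 0"
  shows "J f b = J f a"
  using J_antiderivative[OF assms(1-4), of "\<lambda>_. 0"] assms(5) by (auto simp: continuous_on_const)

text \<open>The fundamental theorem needs the derivative only inside the cell, so a formula for
  \<open>t\<close> on the open cell yields one for its integral on the closed cell. Half-open pieces
  and the closed last piece are thus treated alike.\<close>

lemma J_piece_poly:
  fixes M :: nat
  assumes M: "M > 0" and j: "j \<le> M" and t: "t \<in> L2"
    and q: "degree q \<le> p" "\<And>x. 0 < x \<Longrightarrow> x < 1 \<Longrightarrow> \<bar>x - real j / M\<bar> < 1 / M \<Longrightarrow> t x = poly q x"
  obtains Q where "degree Q \<le> Suc p" "\<And>x. 0 \<le> x \<Longrightarrow> x \<le> 1 \<Longrightarrow> \<bar>x - real j / M\<bar> \<le> 1 / M \<Longrightarrow> c + J t x = poly Q x"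
proof -
  obtain Q where Q: "pderiv Q = q" "degree Q \<le> Suc (degree q)"
    by (rule poly_antiderivative)
  let ?y = "real j / M"
  have y: "0 \<le> ?y" "?y \<le> 1" using j M by auto
  have J: "J t b - J t a = poly Q b - poly Q a" if "0 \<le> a" "a \<le> b" "b \<le> 1" "?y - 1 / M \<le> a" "b \<le> ?y + 1 / M" for a b
  proof (rule J_antiderivative[OF t that(1-3)])
    fix x assume x: "a < x" "x < b"
    then have "t x = poly q x" using that by (intro q(2)) auto
    then show "((poly Q) has_real_derivative t x) (at x)"
      using poly_DERIV[of Q x] Q(1) by simp
  qed (intro continuous_intros)
  show thesis
  proof (rule that[of "Q + [:c + J t ?y - poly Q ?y:]"])
    show "degree (Q + [:c + J t ?y - poly Q ?y:]) \<le> Suc p"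
      using Q(2) q(1) by (intro degree_add_le) auto
    fix x assume x: "0 \<le> x" "x \<le> 1" "\<bar>x - real j / M\<bar> \<le> 1 / M"
    have "J t x - J t ?y = poly Q x - poly Q ?y"
    proof (cases "?y \<le> x")
      case True
      then show ?thesis using x y by (intro J) auto
    next
      case False
      then have "J t ?y - J t x = poly Q ?y - poly Q x" using x y by (intro J) auto
      then show ?thesis by simp
    qed
    then show "c + J t x = poly (Q + [:c + J t ?y - poly Q ?y:]) x" by simp
  qed
qed

text \<open>Integration never moves break points, so the pieces of \<open>s\<close> are the cells of
  the piecewise constant it descends from, whose type is \<open>i + Suc p\<close>. Hence the break
  points alternate with the parity of the degree.\<close>

lemma sp_piece_poly:
  assumes M: "M > 0" and "s \<in> sp M (Suc p) i" "j \<le> M" "even (j + Suc p + i)"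
  shows "\<exists>q. degree q \<le> Suc p \<and> (\<forall>x. 0 \<le> x \<and> x \<le> 1 \<and> \<bar>x - real j / M\<bar> \<le> 1 / M \<longrightarrow> s x = poly q x)"
  using assms(2-)
proof (induction p arbitrary: s i)
  case 0
  obtain c t where t: "t \<in> sp M 0 (Suc i)" "\<And>x. x \<in> {0..1} \<Longrightarrow> s x = c + J t x"
    using sp_antiderivative[OF 0(1)] by metis
  have tL: "t \<in> L2" using t(1) sp_L2 by auto
  obtain a where a: "\<And>x. 0 < x \<Longrightarrow> x < 1 \<Longrightarrow> \<bar>x - real j / M\<bar> < 1 / M \<Longrightarrow> t x = a"
    using sp_base_const[OF M t(1) 0(2)] 0(3) by auto
  obtain Q where "degree Q \<le> Suc 0"
    "\<And>x. 0 \<le> x \<Longrightarrow> x \<le> 1 \<Longrightarrow> \<bar>x - real j / M\<bar> \<le> 1 / M \<Longrightarrow> c + J t x = poly Q x"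
    using J_piece_poly[OF M 0(2) tL, of "[:a:]" 0 c] a by auto
  then show ?case using t(2) by auto
next
  case (Suc p)
  obtain c t where t: "t \<in> sp M (Suc p) (Suc i)" "\<And>x. x \<in> {0..1} \<Longrightarrow> s x = c + J t x"
    using sp_antiderivative[OF Suc.prems(1)] by metis
  have tL: "t \<in> L2" using t(1) sp_L2 by auto
  obtain q where q: "degree q \<le> Suc p" "\<And>x. 0 \<le> x \<and> x \<le> 1 \<and> \<bar>x - real j / M\<bar> \<le> 1 / M \<Longrightarrow> t x = poly q x"
    using Suc.IH[OF t(1) Suc.prems(2)] Suc.prems(3) by auto
  obtain Q where "degree Q \<le> Suc (Suc p)"
    "\<And>x. 0 \<le> x \<Longrightarrow> x \<le> 1 \<Longrightarrow> \<bar>x - real j / M\<bar> \<le> 1 / M \<Longrightarrow> c + J t x = poly Q x"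
    using J_piece_poly[OF M Suc.prems(2) tL q(1), of c] q(2) by auto
  then show ?case using t(2) by auto
qed

section \<open>Derivatives on the closed interval and endpoint conditions\<close>

lemma deriv01_cong:
  assumes "\<And>x. x \<in> {0..1} \<Longrightarrow> f x = g x" "x \<in> {0..1}"
  shows "deriv01 k f x = deriv01 k g x"
  using assms(2)
proof (induction k arbitrary: x)
  case (Suc k)
  then show ?case
    by (auto intro!: vector_derivative_cong_eq)
qed (simp add: assms(1))

text \<open>\<open>deriv01\<close> recurses through the outermost derivative, the induction over
  splines through the innermost one.\<close>

lemma deriv01_shift: "deriv01 (Suc k) f = deriv01 k (deriv01 1 f)"
  by (induction k) auto

lemma has_vector_derivative_J:
  assumes "continuous_on {0..1} t" "\<And>x. x \<in> {0..1} \<Longrightarrow> s x = c + J t x" "x \<in> {0..1}"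
  shows "(s has_vector_derivative t x) (at x within {0..1})"
proof -
  have "((\<lambda>x. c + integral {0..x} t) has_vector_derivative 0 + t x) (at x within {0..1})"
    by (intro has_vector_derivative_add has_vector_derivative_const integral_has_vector_derivative assms)
  then have "((\<lambda>x. c + integral {0..x} t) has_vector_derivative t x) (at x within {0..1})" by simp
  then show ?thesis
    by (rule has_vector_derivative_transform[rotated 2])
       (use assms J_eq_integral(2)[OF L2_continuous_on[OF assms(1)]] in auto)
qed

lemma vector_derivative01_eq:
  fixes s :: "real \<Rightarrow> real"
  assumes "(s has_vector_derivative d) (at x within {0..1})" "x \<in> {0..1::real}"
  shows "vector_derivative s (at x within {0..1}) = d"
  by (rule vector_derivative_within_closed_interval[OF _ assms(2,1)]) simp

lemma sp_continuous:
  assumes "s \<in> sp M (Suc p) i"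
  shows "continuous_on {0..1} s"
proof -
  obtain c t where t: "t \<in> sp M p (Suc i)" "\<And>x. x \<in> {0..1} \<Longrightarrow> s x = c + J t x"
    using sp_antiderivative[OF assms] by metis
  then have "continuous_on {0..1} (\<lambda>x. c + J t x)"
    using subsetD[OF sp_L2 t(1)] by (intro continuous_intros J_continuous)
  then show ?thesis by (subst continuous_on_cong[OF refl t(2)])
qed

text \<open>The derivative of \<open>s\<close> is a spline \<open>t\<close> of type
  \<open>Suc i\<close>, so conditions of positive order pass to \<open>t\<close> with the order
  lowered by one, while order 0 is built into the antiderivative. The order equal to the degree is
  settled in degree 1, where \<open>s\<close> may have kinks but is constant next to an endpoint
  that carries a condition on the derivative.\<close>

lemma sp_Ck01_bc:
  assumes M: "M > 0" and "s \<in> sp M (Suc p) i"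
  shows "s \<in> Ck01 p \<and> (\<forall>\<alpha>\<le>Suc p. (even (\<alpha> + i) \<longrightarrow> deriv01 \<alpha> s 0 = 0) \<and> (even (\<alpha> + i + M) \<longrightarrow> deriv01 \<alpha> s 1 = 0))"
  using assms(2)
proof (induction p arbitrary: s i)
  case 0
  obtain c t where t: "t \<in> sp M 0 (Suc i)" "even i \<Longrightarrow> c = 0" "even (i + M) \<Longrightarrow> c + J t 1 = 0"
    "\<And>x. x \<in> {0..1} \<Longrightarrow> s x = c + J t x"
    using sp_antiderivative[OF 0] by blast
  have tL: "t \<in> L2" using t(1) sp_L2 by auto
  have d0: "deriv01 1 s 0 = 0" if ev: "even (Suc i)"
  proof -
    obtain a where a: "\<And>x. 0 < x \<Longrightarrow> x < 1 \<Longrightarrow> \<bar>x - real 0 / M\<bar> < 1 / M \<Longrightarrow> t x = a" "a = 0"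
      by (rule sp_base_const[OF M t(1), of 0]) (use ev in auto)
    have eq: "s 0 = s x" if x: "x \<in> {0..1}" "dist x 0 < 1 / M" for x
    proof -
      have "J t x = J t 0"
        using x by (intro J_constant_on[OF tL]) (auto simp: a)
      then show ?thesis using t(4)[of x] t(4)[of 0] x(1) by simp
    qed
    have "(s has_vector_derivative 0) (at 0 within {0..1})"
      by (rule has_vector_derivative_transform_within[OF has_vector_derivative_const[of "s 0"], of "1 / M"])
        (use M in simp, simp, rule eq)
    then show ?thesis using vector_derivative01_eq by simp
  qed
  have d1: "deriv01 1 s 1 = 0" if ev: "even (Suc i + M)"
  proof -
    obtain a where a: "\<And>x. 0 < x \<Longrightarrow> x < 1 \<Longrightarrow> \<bar>x - 1\<bar> < 1 / M \<Longrightarrow> t x = a" "a = 0"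
      by (rule sp_base_const[OF M t(1), of M]) (use ev M in \<open>auto simp: add.commute\<close>)
    have eq: "s 1 = s x" if x: "x \<in> {0..1}" "dist x 1 < 1 / M" for x
    proof -
      have "J t 1 = J t x"
        using x by (intro J_constant_on[OF tL]) (auto simp: a dist_real_def)
      then show ?thesis using t(4)[of x] t(4)[of 1] x(1) by simp
    qed
    have "(s has_vector_derivative 0) (at 1 within {0..1})"
      by (rule has_vector_derivative_transform_within[OF has_vector_derivative_const[of "s 1"], of "1 / M"])
        (use M in simp, simp, rule eq)
    then show ?thesis using vector_derivative01_eq by simp
  qed
  have "deriv01 \<alpha> s 0 = 0" if "\<alpha> \<le> Suc 0" "even (\<alpha> + i)" for \<alpha>
    using that d0 t by (cases "\<alpha> = 0") (auto simp: le_Suc_eq)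
  moreover have "deriv01 \<alpha> s 1 = 0" if "\<alpha> \<le> Suc 0" "even (\<alpha> + i + M)" for \<alpha>
    using that d1 t by (cases "\<alpha> = 0") (auto simp: le_Suc_eq)
  ultimately show ?case using sp_continuous[OF 0] by (auto simp: Ck01_def)
next
  case (Suc p)
  obtain c t where t: "t \<in> sp M (Suc p) (Suc i)" "even i \<Longrightarrow> c = 0" "even (i + M) \<Longrightarrow> c + J t 1 = 0"
    "\<And>x. x \<in> {0..1} \<Longrightarrow> s x = c + J t x"
    using sp_antiderivative[OF Suc.prems] by blast
  have der: "(s has_vector_derivative t x) (at x within {0..1})" if "x \<in> {0..1}" for x
    using has_vector_derivative_J[OF sp_continuous[OF t(1)] t(4) that] by simp
  then have "deriv01 1 s x = t x" if "x \<in> {0..1}" for x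
    using vector_derivative01_eq that by auto
  then have shift: "deriv01 (Suc k) s x = deriv01 k t x" if "x \<in> {0..1}" for k x
    unfolding deriv01_shift using that by (intro deriv01_cong) auto
  note IH = Suc.IH[OF t(1)]
  have "deriv01 j s differentiable_on {0..1}" if "j < Suc p" for j
  proof (cases j)
    case 0
    then show ?thesis
      using differentiableI_vector[OF der] by (simp add: differentiable_on_def)
  next
    case (Suc k)
    then have "deriv01 k t differentiable_on {0..1}" using IH that by (auto simp: Ck01_def)
    then show ?thesis
      unfolding differentiable_on_def Suc
      by (metis differentiable_transform_within[where d = 1] shift zero_less_one)
  qed
  moreover have "continuous_on {0..1} (deriv01 (Suc p) s)"
    using IH by (subst continuous_on_cong[OF refl shift]) (simp_all add: Ck01_def)
  ultimately have "s \<in> Ck01 (Suc p)" by (auto simp: Ck01_def)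
  moreover have "(even (\<alpha> + i) \<longrightarrow> deriv01 \<alpha> s 0 = 0) \<and> (even (\<alpha> + i + M) \<longrightarrow> deriv01 \<alpha> s 1 = 0)"
    if "\<alpha> \<le> Suc (Suc p)" for \<alpha>
  proof (cases \<alpha>)
    case 0
    then show ?thesis using t by auto
  next
    case (Suc \<beta>)
    have "deriv01 \<alpha> s 0 = deriv01 \<beta> t 0" "deriv01 \<alpha> s 1 = deriv01 \<beta> t 1"
      unfolding Suc by (intro shift; simp)+
    then show ?thesis using IH that by (auto simp: Suc)
  qed
  ultimately show ?case by blast
qed

section \<open>The optimal break points on the half-cell grid\<close>

definition half_cells :: "nat \<Rightarrow> nat \<Rightarrow> nat" where
  "half_cells n i = (if i = 0 then 2 * n + 2 else if i = 1 then 2 * n else 2 * n + 1)"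

text \<open>Six lists become one arithmetic progression over \<open>half_cells n i\<close>, which is
  \<open>2 / h\<close>. The first piece is a half cell for \<open>a = 1\<close> and a full cell for
  \<open>a = 2\<close>; the last one is full if \<open>a + 2 * len\<close> is the number of half
  cells and a half cell otherwise.\<close>

lemma tau_opt_nodes:
  assumes "i \<in> {0, 1, 2}" "n \<ge> 1"
  obtains a len where "a = 1 \<or> a = 2" "odd (a + p + i)" "a + 2 * len = half_cells n i \<or> a + 2 * len = Suc (half_cells n i)"
    "tau_opt p n i = [0] @ map (\<lambda>k. real (a + 2 * k) / real (half_cells n i)) [0..<len] @ [1]"
proof -
  have shift: "map f [1..<m + 1] = map (\<lambda>k. f (Suc k)) [0..<m]" for f :: "nat \<Rightarrow> real" and m
    by (simp add: map_Suc_upt[symmetric] o_def del: upt_Suc)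
  have shift': "map f [1..<n] = map (\<lambda>k. f (Suc k)) [0..<n - 1]" for f :: "nat \<Rightarrow> real"
    using shift[of f "n - 1"] assms(2) by simp
  consider "i = 0" "odd p" | "i = 0" "even p" | "i = 1" "odd p" | "i = 1" "even p" | "i = 2" "odd p" | "i = 2" "even p"
    using assms(1) by auto
  then show thesis
  proof cases
    case 1
    have "map (\<lambda>k. real k / (real n + 1)) [1..<n + 1] = map (\<lambda>k. real (2 + 2 * k) / real (2 * n + 2)) [0..<n]"
      unfolding shift by (intro map_cong refl) (simp add: divide_simps; simp add: algebra_simps)
    with 1 show thesis
      by (intro that[of 2 n]) (simp_all add: half_cells_def tau_opt_def)
  next
    case 2
    have "map (\<lambda>k. (real k + 1/2) / (real n + 1)) [0..<n + 1] = map (\<lambda>k. real (1 + 2 * k) / real (2 * n + 2)) [0..<n + 1]"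
      by (intro map_cong refl) (simp add: divide_simps; simp add: algebra_simps)
    with 2 show thesis
      by (intro that[of 1 "n + 1"]) (simp_all add: half_cells_def tau_opt_def)
  next
    case 3
    have "map (\<lambda>k. (real k + 1/2) / real n) [0..<n] = map (\<lambda>k. real (1 + 2 * k) / real (2 * n)) [0..<n]"
      by (intro map_cong refl) (simp add: divide_simps; simp add: algebra_simps)
    with 3 show thesis
      by (intro that[of 1 n]) (simp_all add: half_cells_def tau_opt_def)
  next
    case 4
    have "map (\<lambda>k. real k / real n) [1..<n] = map (\<lambda>k. real (2 + 2 * k) / real (2 * n)) [0..<n - 1]"
      unfolding shift' by (intro map_cong refl) (simp add: divide_simps; simp add: algebra_simps)
    moreover have "2 + 2 * (n - 1) = 2 * n" using assms(2) by arith
    ultimately show thesis using 4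
      by (intro that[of 2 "n - 1"]) (simp_all add: half_cells_def tau_opt_def)
  next
    case 5
    have "map (\<lambda>k. 2 * real k / (2 * real n + 1)) [1..<n + 1] = map (\<lambda>k. real (2 + 2 * k) / real (2 * n + 1)) [0..<n]"
      unfolding shift by (intro map_cong refl) simp
    with 5 show thesis
      by (intro that[of 2 n]) (simp_all add: half_cells_def tau_opt_def)
  next
    case 6
    have "map (\<lambda>k. (2 * real k + 1) / (2 * real n + 1)) [0..<n] = map (\<lambda>k. real (1 + 2 * k) / real (2 * n + 1)) [0..<n]"
      by (intro map_cong refl) (simp add: add.commute)
    with 6 show thesis
      by (intro that[of 1 n]) (simp_all add: half_cells_def tau_opt_def)
  qed
qed

lemma piece_subset:
  assumes "i \<in> {0, 1, 2}" "n \<ge> 1" "Suc j < length (tau_opt p n i)"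
  obtains l where "l \<le> half_cells n i" "even (l + p + i)"
    "\<And>x. x \<in> piece (tau_opt p n i) j \<Longrightarrow> 0 \<le> x \<and> x \<le> 1 \<and> \<bar>x - real l / half_cells n i\<bar> \<le> 1 / half_cells n i"
proof -
  define M where "M = half_cells n i"
  have M: "M > 0" using assms(2) by (auto simp: M_def half_cells_def)
  obtain a len where a: "a = 1 \<or> a = 2" "odd (a + p + i)" "a + 2 * len = M \<or> a + 2 * len = Suc M"
    and tau: "tau_opt p n i = [0] @ map (\<lambda>k. real (a + 2 * k) / real M) [0..<len] @ [1]"
    unfolding M_def by (rule tau_opt_nodes[OF assms(1,2), of p])
  have j: "j \<le> len" using assms(3) by (simp add: tau)
  \<comment> \<open>The midpoint lies one half cell to the left of the right break point
    \<open>a + 2 * j\<close> of the uncut cell. For a half cell at an end of the interval this gives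
    0 or \<open>M\<close>.\<close>
  define l where "l = a + 2 * j - 1"
  have lM: "l \<le> M" using a j by (auto simp: l_def)
  have l: "real l = real a + 2 * real j - 1" using a(1) by (auto simp: l_def)
  have lo: "0 \<le> tau_opt p n i ! j" "real l / M - 1 / M \<le> tau_opt p n i ! j"
  proof -
    have "0 \<le> tau_opt p n i ! j \<and> (real l - 1) / M \<le> tau_opt p n i ! j"
    proof (cases j)
      case 0
      then show ?thesis using a(1) M by (auto simp: tau l divide_nonpos_pos)
    next
      case (Suc k)
      then show ?thesis using j M by (auto simp: tau l nth_append intro!: divide_right_mono)
    qed
    then show "0 \<le> tau_opt p n i ! j" "real l / M - 1 / M \<le> tau_opt p n i ! j"
      by (auto simp: diff_divide_distrib)
  qed
  have hi: "tau_opt p n i ! Suc j \<le> 1" "tau_opt p n i ! Suc j \<le> real l / M + 1 / M"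
  proof -
    have "tau_opt p n i ! Suc j \<le> 1 \<and> tau_opt p n i ! Suc j \<le> (real l + 1) / M"
    proof (cases "j < len")
      case True
      then have "a + 2 * j \<le> M" using a by auto
      then have "real a + 2 * real j \<le> real M" by linarith
      then show ?thesis using True M by (auto simp: tau l nth_append)
    next
      case False
      then have "M \<le> l + 1" using a j by (auto simp: l_def)
      then have "real M \<le> real l + 1" by linarith
      then show ?thesis using False j M by (auto simp: tau nth_append)
    qed
    then show "tau_opt p n i ! Suc j \<le> 1" "tau_opt p n i ! Suc j \<le> real l / M + 1 / M"
      by (auto simp: add_divide_distrib)
  qed
  show thesis
  proof (rule that[of l])
    show "l \<le> half_cells n i" using lM by (simp add: M_def)
    show "even (l + p + i)" using a(1,2) by (auto simp: l_def)
    fix x assume "x \<in> piece (tau_opt p n i) j"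
    then have "tau_opt p n i ! j \<le> x" "x \<le> tau_opt p n i ! Suc j"
      by (auto simp: piece_def split: if_splits)
    then show "0 \<le> x \<and> x \<le> 1 \<and> \<bar>x - real l / half_cells n i\<bar> \<le> 1 / half_cells n i"
      using lo hi unfolding M_def[symmetric] abs_le_iff by linarith
  qed
qed

lemma sp_spline_opt:
  assumes i: "i \<in> {0, 1, 2}" and n: "n \<ge> 1" and s: "s \<in> sp (half_cells n i) (Suc p) i"
  shows "s \<in> spline_opt (Suc p) n i"
proof -
  have M: "half_cells n i > 0" using n by (auto simp: half_cells_def)
  have "\<exists>q. degree q \<le> Suc p \<and> (\<forall>x\<in>piece (tau_opt (Suc p) n i) j. s x = poly q x)"
    if jl: "Suc j < length (tau_opt (Suc p) n i)" for j
  proof (rule piece_subset[OF i n jl])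
    fix l
    assume l: "l \<le> half_cells n i" "even (l + Suc p + i)"
      "\<And>x. x \<in> piece (tau_opt (Suc p) n i) j \<Longrightarrow> 0 \<le> x \<and> x \<le> 1 \<and> \<bar>x - real l / half_cells n i\<bar> \<le> 1 / half_cells n i"
    show ?thesis using sp_piece_poly[OF M s l(1,2)] l(3) by blast
  qed
  then have "s \<in> spline (Suc p) (tau_opt (Suc p) n i)"
    using sp_Ck01_bc[OF M s] by (simp add: spline_def)
  moreover have "boundary_cond i {..Suc p} (\<lambda>\<alpha>. deriv01 \<alpha> s)"
    using sp_Ck01_bc[OF M s] i by (auto simp: boundary_cond_def half_cells_def simp del: deriv01.simps)
  ultimately show ?thesis by (simp add: spline_opt_def spline_bc_def)
qed

subsection \<open>Smooth bump functions\<close>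

text \<open>The classical \<open>exp (- 1 / x)\<close>, with a polynomial in \<open>1 / x\<close> as
  a factor so that the family is closed under differentiation, also across 0.\<close>

definition flat :: "real poly \<Rightarrow> real \<Rightarrow> real" where
  "flat q x = (if x > 0 then poly q (1 / x) * exp (- (1 / x)) else 0)"

lemma tendsto_poly_exp: "((\<lambda>y. poly q y * exp (- y)) \<longlongrightarrow> (0::real)) at_top"
proof -
  have "((\<lambda>y. \<Sum>k\<le>degree q. coeff q k * (y ^ k / exp y)) \<longlongrightarrow> (\<Sum>k\<le>degree q. coeff q k * 0)) at_top"
    by (intro tendsto_sum tendsto_mult tendsto_const tendsto_power_div_exp_0)
  then show ?thesis
    by (simp add: poly_altdef sum_distrib_right exp_minus divide_inverse mult.assoc)
qed

lemma flat_deriv: "(flat q has_real_derivative flat ([:0, 0, 1:] * (q - pderiv q)) x) (at x)"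
proof -
  consider "x < 0" | "x > 0" | "x = 0" by linarith
  then show ?thesis
  proof cases
    case 1
    have "((\<lambda>_. 0) has_real_derivative 0) (at x)" by simp
    then show ?thesis
      using 1 by (subst DERIV_cong_ev[of _ x "flat q" "\<lambda>_. 0" _ 0])
        (auto simp: flat_def eventually_nhds_in_open intro: eventually_mono[OF eventually_nhds_in_open[of "{..<0}" x]])
  next
    case 2
    have "((\<lambda>x. poly q (1 / x) * exp (- (1 / x))) has_real_derivative
        poly ([:0, 0, 1:] * (q - pderiv q)) (1 / x) * exp (- (1 / x))) (at x)"
      using 2 by (auto intro!: derivative_eq_intros simp: field_simps power2_eq_square)
    then show ?thesis
      using 2 by (subst DERIV_cong_ev[of _ x "flat q" "\<lambda>x. poly q (1 / x) * exp (- (1 / x))", OF refl _ refl])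
        (auto simp: flat_def intro: eventually_mono[OF eventually_nhds_in_open[of "{0<..}" x]])
  next
    case 3
    have "((\<lambda>y. poly ([:0, 1:] * q) y * exp (- y)) \<longlongrightarrow> 0) at_top"
      by (rule tendsto_poly_exp)
    then have "((\<lambda>h. poly ([:0, 1:] * q) (inverse h) * exp (- inverse h)) \<longlongrightarrow> 0) (at_right 0)"
      by (rule filterlim_compose[OF _ filterlim_inverse_at_top_right])
    then have "((\<lambda>h. flat q h / h) \<longlongrightarrow> 0) (at_right 0)"
      by (rule Lim_transform_eventually)
         (auto simp: flat_def field_simps eventually_at_filter)
    moreover have "((\<lambda>h. flat q h / h) \<longlongrightarrow> 0) (at_left 0)"
      by (rule Lim_transform_eventually[OF tendsto_const])
         (auto simp: flat_def eventually_at_filter)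
    ultimately have "((\<lambda>h. flat q h / h) \<longlongrightarrow> 0) (at 0)"
      by (simp add: filterlim_split_at)
    then show ?thesis
      using 3 by (simp add: has_field_derivative_iff flat_def)
  qed
qed

text \<open>Each rule is compatible with differentiation, so a single differentiation step already
  yields derivatives of all orders.\<close>

inductive_set smooth_fun :: "(real \<Rightarrow> real) set" where
  const: "(\<lambda>_. c) \<in> smooth_fun"
| flat: "(\<lambda>x. flat q (a * x + b)) \<in> smooth_fun"
| add: "f \<in> smooth_fun \<Longrightarrow> g \<in> smooth_fun \<Longrightarrow> (\<lambda>x. f x + g x) \<in> smooth_fun"
| mult: "f \<in> smooth_fun \<Longrightarrow> g \<in> smooth_fun \<Longrightarrow> (\<lambda>x. f x * g x) \<in> smooth_fun"

lemma smooth_fun_deriv: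
  assumes "f \<in> smooth_fun"
  shows "\<exists>g\<in>smooth_fun. \<forall>x. (f has_real_derivative g x) (at x)"
  using assms
proof (induction rule: smooth_fun.induct)
  case (const c)
  show ?case by (intro bexI[of _ "\<lambda>_. 0"]) (auto intro: smooth_fun.const)
next
  case (flat q a b)
  have "((\<lambda>x. flat q (a * x + b)) has_real_derivative flat ([:0, 0, 1:] * (q - pderiv q)) (a * x + b) * a) (at x)" for x
    by (rule DERIV_chain'[OF _ flat_deriv]) (auto intro!: derivative_eq_intros)
  then show ?case
    by (intro bexI[of _ "\<lambda>x. flat ([:0, 0, 1:] * (q - pderiv q)) (a * x + b) * a"])
       (auto intro!: smooth_fun.intros)
next
  case (add f g)
  then obtain f' g' where "f' \<in> smooth_fun" "g' \<in> smooth_fun"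
    "\<And>x. (f has_real_derivative f' x) (at x)" "\<And>x. (g has_real_derivative g' x) (at x)" by blast
  then show ?case
    by (intro bexI[of _ "\<lambda>x. f' x + g' x"] allI DERIV_add smooth_fun.add)
next
  case (mult f g)
  then obtain f' g' where *: "f' \<in> smooth_fun" "g' \<in> smooth_fun"
    "\<And>x. (f has_real_derivative f' x) (at x)" "\<And>x. (g has_real_derivative g' x) (at x)" by blast
  have "(\<lambda>x. f' x * g x + g' x * f x) \<in> smooth_fun"
    using * mult.hyps by (intro smooth_fun.add smooth_fun.mult)
  then show ?case
    using * by (intro bexI[of _ "\<lambda>x. f' x * g x + g' x * f x"] allI DERIV_mult)
qed

lemma smooth_fun_funpow: "f \<in> smooth_fun \<Longrightarrow> (deriv ^^ k) f \<in> smooth_fun"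
proof (induction k)
  case (Suc k)
  then obtain g where "g \<in> smooth_fun" "\<forall>x. ((deriv ^^ k) f has_real_derivative g x) (at x)"
    using smooth_fun_deriv by blast
  moreover from this have "deriv ((deriv ^^ k) f) = g"
    by (intro ext DERIV_imp_deriv) auto
  ultimately show ?case by simp
qed simp

lemma smooth_fun_differentiable: "f \<in> smooth_fun \<Longrightarrow> (deriv ^^ k) f field_differentiable at x"
  using smooth_fun_deriv[OF smooth_fun_funpow] by (force simp: field_differentiable_def)

text \<open>Growing \<open>n\<close> steepens the flanks while the support stays in
  \<open>[a, b]\<close>: a bounded approximation of the indicator of the open interval.\<close>

definition bump :: "real \<Rightarrow> real \<Rightarrow> nat \<Rightarrow> real \<Rightarrow> real" where
  "bump a b n x = flat 1 (real (Suc n) * (x - a)) * flat 1 (real (Suc n) * (b - x))"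

lemma bump_smooth: "bump a b n \<in> smooth_fun"
proof -
  have "bump a b n = (\<lambda>x. flat 1 (real (Suc n) * x + - real (Suc n) * a) * flat 1 (- real (Suc n) * x + real (Suc n) * b))"
    by (auto simp: bump_def algebra_simps)
  moreover have "\<dots> \<in> smooth_fun" by (intro smooth_fun.intros)
  ultimately show ?thesis by simp
qed

lemma bump_pos: "a < x \<Longrightarrow> x < b \<Longrightarrow> bump a b n x > 0"
  by (simp add: bump_def flat_def)

lemma bump_zero: "x \<le> a \<or> b \<le> x \<Longrightarrow> bump a b n x = 0"
  by (auto simp: bump_def flat_def mult_le_0_iff not_less zero_less_mult_iff)

lemma bump_le_1: "\<bar>bump a b n x\<bar> \<le> 1"
proof -
  have "\<bar>flat 1 y\<bar> \<le> 1" for y by (simp add: flat_def)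
  then show ?thesis unfolding bump_def abs_mult by (intro mult_le_one) auto
qed

lemma bump_limit: "(\<lambda>n. bump a b n x) \<longlonglongrightarrow> (if a < x \<and> x < b then 1 else 0)"
proof (cases "a < x \<and> x < b")
  case True
  have "(\<lambda>n. flat 1 (real (Suc n) * y)) \<longlonglongrightarrow> 1" if "y > 0" for y
  proof -
    have "(\<lambda>n. exp (- (inverse (real (Suc n)) * (1 / y)))) \<longlonglongrightarrow> exp (- (0 * (1 / y)))"
      by (intro tendsto_intros LIMSEQ_inverse_real_of_nat)
    moreover have "exp (- (inverse (real (Suc n)) * (1 / y))) = flat 1 (real (Suc n) * y)" for n
      using that by (simp add: flat_def divide_inverse)
    ultimately show ?thesis by simp
  qed
  then have "(\<lambda>n. bump a b n x) \<longlonglongrightarrow> 1 * 1"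
    unfolding bump_def using True by (intro tendsto_mult) auto
  then show ?thesis using True by simp
next
  case False
  then have "bump a b n x = 0" for n by (intro bump_zero) auto
  then show ?thesis unfolding if_not_P[OF False] by simp
qed

lemma bump_test:
  assumes "0 < a" "b < 1"
  shows "bump a b n \<in> test_functions"
proof -
  have "{x. bump a b n x \<noteq> 0} \<subseteq> {a..b}"
  proof
    fix x assume "x \<in> {x. bump a b n x \<noteq> 0}"
    then have "\<not> (x \<le> a \<or> b \<le> x)" using bump_zero[of x a b n] by auto
    then show "x \<in> {a..b}" by auto
  qed
  then have "closure {x. bump a b n x \<noteq> 0} \<subseteq> {a..b}"
    by (rule closure_minimal) simp
  then show ?thesis
    using assms smooth_fun_differentiable[OF bump_smooth] by (auto simp: test_functions_def)
qed

subsection \<open>The fundamental lemma of the calculus of variations\<close>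

lemma test_support:
  assumes "\<phi> \<in> test_functions"
  obtains a b where "0 < a" "a < b" "b < 1" "\<And>x. x < a \<or> b < x \<Longrightarrow> \<phi> x = 0"
proof -
  let ?C = "closure {x. \<phi> x \<noteq> 0}"
  have C: "?C \<subseteq> {0<..<1}" using assms by (simp add: test_functions_def)
  then have "bounded ?C" by (rule bounded_subset[rotated]) simp
  then have comp: "compact ?C" by (simp add: compact_eq_bounded_closed)
  show thesis
  proof (cases "?C = {}")
    case True
    then have "\<phi> x = 0" for x by simp
    then show thesis by (intro that[of "1/3" "2/3"]) auto
  next
    case False
    obtain l where l: "l \<in> ?C" "\<forall>x\<in>?C. l \<le> x" using compact_attains_inf[OF comp False] by blast
    obtain m where m: "m \<in> ?C" "\<forall>x\<in>?C. x \<le> m" using compact_attains_sup[OF comp False] by blast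
    have lm: "0 < l" "l \<le> m" "m < 1" using l m C by auto
    have "\<phi> x = 0" if "x < l \<or> m < x" for x
      using that l(2) m(2) closure_subset[of "{x. \<phi> x \<noteq> 0}"] by force
    then show thesis
      using lm by (intro that[of "l / 2" "(m + 1) / 2"]) auto
  qed
qed

lemma test_funpow_differentiable: "\<phi> \<in> test_functions \<Longrightarrow> (deriv ^^ k) \<phi> field_differentiable at x"
  by (simp add: test_functions_def)

lemma test_differentiable: "\<phi> \<in> test_functions \<Longrightarrow> \<phi> field_differentiable at x"
  using test_funpow_differentiable[of \<phi> 0] by simp

lemma test_has_deriv: "\<phi> \<in> test_functions \<Longrightarrow> (\<phi> has_real_derivative deriv \<phi> x) (at x)"
  using test_differentiable by (simp add: DERIV_deriv_iff_field_differentiable)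

lemma test_continuous: "\<phi> \<in> test_functions \<Longrightarrow> continuous_on S \<phi>"
  using test_has_deriv by (meson DERIV_isCont continuous_at_imp_continuous_on)

lemma test_L2: "\<phi> \<in> test_functions \<Longrightarrow> \<phi> \<in> L2"
  by (intro L2_continuous_on test_continuous)

lemma test_deriv:
  assumes "\<phi> \<in> test_functions"
  shows "deriv \<phi> \<in> test_functions"
proof -
  obtain a b where ab: "0 < a" "a < b" "b < 1" "\<And>x. x < a \<or> b < x \<Longrightarrow> \<phi> x = 0"
    by (rule test_support[OF assms]) blast
  have "deriv \<phi> x = 0" if "x < a \<or> b < x" for x
  proof -
    have "eventually (\<lambda>y. y \<in> {..<a} \<union> {b<..}) (nhds x)"
      using that by (intro eventually_nhds_in_open) auto
    then have "eventually (\<lambda>y. \<phi> y = 0) (nhds x)"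
      by (rule eventually_mono) (use ab(4) in auto)
    then have "deriv \<phi> x = deriv (\<lambda>_. 0) x" by (intro deriv_cong_ev) auto
    then show ?thesis by simp
  qed
  then have "{x. deriv \<phi> x \<noteq> 0} \<subseteq> {a..b}" by force
  then have "closure {x. deriv \<phi> x \<noteq> 0} \<subseteq> {a..b}" by (rule closure_minimal) simp
  moreover have "(deriv ^^ k) (deriv \<phi>) field_differentiable at x" for k x
    using test_funpow_differentiable[OF assms, of "Suc k"] by (simp add: funpow_swap1)
  ultimately show ?thesis using ab by (auto simp: test_functions_def)
qed

lemma test_diff_cmult:
  assumes "\<phi> \<in> test_functions" "\<psi> \<in> test_functions"
  shows "(\<lambda>x. \<phi> x - c * \<psi> x) \<in> test_functions"
proof -
  have eq: "(deriv ^^ k) (\<lambda>x. \<phi> x - c * \<psi> x) = (\<lambda>x. (deriv ^^ k) \<phi> x - c * (deriv ^^ k) \<psi> x)" for k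
  proof (induction k)
    case (Suc k)
    have "((\<lambda>x. (deriv ^^ k) \<phi> x - c * (deriv ^^ k) \<psi> x) has_real_derivative
        (deriv ^^ Suc k) \<phi> x - c * (deriv ^^ Suc k) \<psi> x) (at x)" for x
      using test_funpow_differentiable[OF assms(1), of k x] test_funpow_differentiable[OF assms(2), of k x]
      by (intro DERIV_diff DERIV_cmult) (simp_all add: DERIV_deriv_iff_field_differentiable)
    then show ?case by (intro ext) (simp add: Suc.IH DERIV_imp_deriv)
  qed simp
  have "(deriv ^^ k) (\<lambda>x. \<phi> x - c * \<psi> x) field_differentiable at x" for k x
    unfolding eq using test_funpow_differentiable assms
    by (intro field_differentiable_diff field_differentiable_mult field_differentiable_const)
  moreover
  obtain a b where ab: "0 < a" "a < b" "b < 1" "\<And>x. x < a \<or> b < x \<Longrightarrow> \<phi> x = 0"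
    by (rule test_support[OF assms(1)]) blast
  obtain a' b' where ab': "0 < a'" "a' < b'" "b' < 1" "\<And>x. x < a' \<or> b' < x \<Longrightarrow> \<psi> x = 0"
    by (rule test_support[OF assms(2)]) blast
  have "{x. \<phi> x - c * \<psi> x \<noteq> 0} \<subseteq> {min a a'..max b b'}"
  proof
    fix x assume "x \<in> {x. \<phi> x - c * \<psi> x \<noteq> 0}"
    then have "\<not> (x < a \<or> b < x) \<or> \<not> (x < a' \<or> b' < x)" using ab(4)[of x] ab'(4)[of x] by auto
    then show "x \<in> {min a a'..max b b'}" by auto
  qed
  then have "closure {x. \<phi> x - c * \<psi> x \<noteq> 0} \<subseteq> {min a a'..max b b'}" by (rule closure_minimal) simp
  moreover have "{min a a'..max b b'} \<subseteq> {0<..<1}" using ab ab' by auto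
  ultimately show ?thesis by (auto simp: test_functions_def)
qed

text \<open>Zero total integral is what makes \<open>J \<phi>\<close> return to 0 beyond the support
  of \<open>\<phi>\<close>.\<close>

lemma test_J:
  assumes \<phi>: "\<phi> \<in> test_functions" and "J \<phi> 1 = 0"
  shows "J \<phi> \<in> test_functions" "deriv (J \<phi>) = \<phi>"
proof -
  obtain a b where ab: "0 < a" "a < b" "b < 1" "\<And>x. x < a \<or> b < x \<Longrightarrow> \<phi> x = 0"
    by (rule test_support[OF \<phi>]) blast
  have left: "J \<phi> x = 0" if "x < a" for x
    using J_cong[of x \<phi> "\<lambda>_. 0"] ab(4) that by auto
  have right: "J \<phi> x = 0" if "b < x" for x
  proof -
    have "J \<phi> 1 = J \<phi> x"
    proof (cases "x \<le> 1")
      case True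
      then show ?thesis
        using that ab by (intro J_constant_on[OF test_L2[OF \<phi>]]) auto
    next
      case False
      then show ?thesis using J_clamp[of \<phi> x] by simp
    qed
    then show ?thesis using assms(2) by simp
  qed
  have der: "(J \<phi> has_real_derivative \<phi> x) (at x)" for x
  proof -
    consider "x < a" | "b < x" | "0 < x" "x < 1" using ab by linarith
    then show ?thesis
    proof cases
      case 1
      then have "eventually (\<lambda>y. J \<phi> y = 0) (nhds x)"
        using left by (auto intro: eventually_mono[OF eventually_nhds_in_open[of "{..<a}" x]])
      then show ?thesis using ab(4)[of x] 1 DERIV_cong_ev[of x x "J \<phi>" "\<lambda>_. 0" "\<phi> x" 0] by simp
    next
      case 2
      then have "eventually (\<lambda>y. J \<phi> y = 0) (nhds x)"
        using right by (auto intro: eventually_mono[OF eventually_nhds_in_open[of "{b<..}" x]])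
      then show ?thesis using ab(4)[of x] 2 DERIV_cong_ev[of x x "J \<phi>" "\<lambda>_. 0" "\<phi> x" 0] by simp
    next
      case 3
      have "(J \<phi> has_vector_derivative \<phi> x) (at x within {0..1})"
        using 3 by (intro has_vector_derivative_J[of _ _ 0] test_continuous[OF \<phi>]) auto
      then have "(J \<phi> has_real_derivative \<phi> x) (at x within {0..1})"
        by (simp add: has_real_derivative_iff_has_vector_derivative)
      then show ?thesis using 3 at_within_Icc_at[of 0 x 1] by simp
    qed
  qed
  then show d: "deriv (J \<phi>) = \<phi>" by (intro ext DERIV_imp_deriv)
  have "(deriv ^^ k) (J \<phi>) field_differentiable at x" for k x
  proof (cases k)
    case 0
    then show ?thesis using der by (auto simp: field_differentiable_def)
  next
    case (Suc l)
    then have "(deriv ^^ k) (J \<phi>) = (deriv ^^ l) \<phi>" by (simp add: funpow_swap1 d)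
    then show ?thesis using test_funpow_differentiable[OF \<phi>] by simp
  qed
  moreover have "{x. J \<phi> x \<noteq> 0} \<subseteq> {a..b}" using left right by force
  then have "closure {x. J \<phi> x \<noteq> 0} \<subseteq> {a..b}" by (rule closure_minimal) simp
  ultimately show "J \<phi> \<in> test_functions" using ab by (auto simp: test_functions_def)
qed

text \<open>Half lines form an intersection-stable generator of the Borel sets, so by Dynkin's
  argument \<open>w\<close> integrates to 0 over every Borel set, and uniqueness of densities
  finishes.\<close>

lemma J_zero_imp_AE_zero:
  assumes w: "w \<in> L2" and J: "\<And>x. x \<in> {0..1} \<Longrightarrow> J w x = 0"
  shows "AE x in L01. w x = 0"
proof -
  define e where "e = (\<lambda>x. indicator {0<..<1} x * w x)"
  have L01e: "(\<integral>x. f x \<partial>L01) = (\<integral>x. indicator {0<..<1} x * f x \<partial>lebesgue)" for f :: "real \<Rightarrow> real"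
    by (subst integral_restrict_space) auto
  have ei: "integrable lebesgue e"
    using L2_integrable[OF w] by (simp add: integrable_restrict_space e_def)
  have si: "set_integrable lebesgue A e" if "A \<in> sets lebesgue" for A
    using integrable_mult_indicator[OF that ei] by (simp add: set_integrable_def)
  have tot: "(\<integral>x. e x \<partial>lebesgue) = 0"
    using J[of 1] L01e[of w] by (simp add: J_1 ip_def e_def)
  have gen: "sets lborel = sigma_sets UNIV (range (atMost :: real \<Rightarrow> real set))"
    by (simp add: borel_eq_atMost)
  then have leb: "A \<in> sets lebesgue" if "A \<in> sigma_sets UNIV (range atMost)" for A :: "real set"
    using that by (intro sets_completionI_sets) simp
  have sub: "range atMost \<subseteq> Pow (UNIV :: real set)" by simp
  have int: "Int_stable (range (atMost :: real \<Rightarrow> real set))"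
  proof (rule Int_stableI)
    fix a b :: "real set" assume "a \<in> range atMost" "b \<in> range atMost"
    then obtain x y where "a = {..x}" "b = {..y}" by auto
    then have "a \<inter> b = {..min x y}" by auto
    then show "a \<inter> b \<in> range atMost" by simp
  qed
  have borel: "set_lebesgue_integral lebesgue A e = 0" if "A \<in> sigma_sets UNIV (range atMost)" for A
    using int sub that
  proof (induction rule: sigma_sets_induct_disjoint)
    case (basic A)
    then obtain x where A: "A = {..x}" by auto
    have "set_lebesgue_integral lebesgue A e = J w x"
      unfolding J_def L01e set_lebesgue_integral_def
      by (intro Bochner_Integration.integral_cong) (auto simp: A e_def indicator_def)
    also have "\<dots> = 0" using J[of "max 0 (min x 1)"] J_clamp[of w x] by simp
    finally show ?case .
  next
    case empty
    then show ?case by (simp add: set_lebesgue_integral_def)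
  next
    case (compl A)
    have A: "A \<in> sets lebesgue" using compl(1) by (rule leb)
    have "set_lebesgue_integral lebesgue (UNIV - A) e = (\<integral>x. e x - indicator A x *\<^sub>R e x \<partial>lebesgue)"
      unfolding set_lebesgue_integral_def by (intro Bochner_Integration.integral_cong) (auto simp: indicator_def)
    also have "\<dots> = 0"
      using ei si[OF A] compl(2) tot by (simp add: set_integrable_def set_lebesgue_integral_def)
    finally show ?case .
  next
    case (union A)
    have A: "A i \<in> sets lebesgue" for i
      using union(2) by (intro leb) auto
    have "set_lebesgue_integral lebesgue (\<Union>i. A i) e = (\<Sum>i. set_lebesgue_integral lebesgue (A i) e)"
      using union(1) A by (intro lebesgue_integral_countable_add si) (auto simp: disjoint_family_on_def)
    then show ?case using union(3) by simp
  qed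
  have "AE x in lebesgue. e x = (\<lambda>_. 0) x"
  proof (rule density_unique_real[OF ei])
    fix A :: "real set" assume "A \<in> sets lebesgue"
    \<comment> \<open>A Lebesgue set is a Borel set up to a subset of a null set, which reduces the
      claim to \<open>borel\<close>.\<close>
    then obtain S N N' where A: "A = S \<union> N" "N \<subseteq> N'" "N' \<in> null_sets lborel" "S \<in> sets lborel"
      by (rule sets_completionE)
    have "AE x in lebesgue. x \<notin> N'"
      using A(3) by (intro AE_not_in null_sets_completionI)
    then have "set_lebesgue_integral lebesgue A e = set_lebesgue_integral lebesgue S e"
      unfolding set_lebesgue_integral_def
      using \<open>A \<in> sets lebesgue\<close> A ei
      by (intro integral_cong_AE borel_measurable_scaleR borel_measurable_indicator borel_measurable_integrable)
         (auto elim!: eventually_mono simp: indicator_def)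
    also have "\<dots> = 0"
      using A(4) unfolding gen by (rule borel)
    finally show "set_lebesgue_integral lebesgue A e = set_lebesgue_integral lebesgue A (\<lambda>_. 0)"
      by (simp add: set_lebesgue_integral_def)
  qed simp
  then show ?thesis
    by (subst AE_restrict_space_iff) (auto elim!: eventually_mono simp: e_def)
qed

text \<open>Bumps converge boundedly to the indicator of \<open>(a, b)\<close>, so orthogonality
  makes \<open>J w\<close> constant inside the interval; continuity and \<open>J w 0 = 0\<close>
  make it zero.\<close>

lemma fundamental_lemma:
  assumes w: "w \<in> L2" and orth: "\<And>\<phi>. \<phi> \<in> test_functions \<Longrightarrow> ip w \<phi> = 0"
  shows "AE x in L01. w x = 0"
proof -
  have eq: "J w b = J w a" if ab: "0 < a" "a < b" "b < 1" for a b
  proof -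
    have "(\<lambda>n. \<integral>x. w x * bump a b n x \<partial>L01) \<longlonglongrightarrow> (\<integral>x. w x * (if a < x \<and> x < b then 1 else 0) \<partial>L01)"
    proof (rule integral_dominated_convergence)
      show "integrable L01 (\<lambda>x. \<bar>w x\<bar>)" using L2_integrable[OF w] by simp
      show "AE x in L01. (\<lambda>n. w x * bump a b n x) \<longlonglongrightarrow> w x * (if a < x \<and> x < b then 1 else 0)"
        by (intro AE_I2 tendsto_mult tendsto_const bump_limit)
      show "AE x in L01. norm (w x * bump a b n x) \<le> \<bar>w x\<bar>" for n
        using bump_le_1 by (intro AE_I2) (simp add: abs_mult mult_left_le)
      show "(\<lambda>x. w x * bump a b n x) \<in> borel_measurable L01" for n
        using w test_L2[OF bump_test[OF ab(1,3)]] by (intro borel_measurable_times L2_measurable) auto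
      show "(\<lambda>x. w x * (if a < x \<and> x < b then 1 else 0)) \<in> borel_measurable L01"
        using w by (intro borel_measurable_times L2_measurable borel_measurable_L01) auto
    qed
    moreover have "(\<integral>x. w x * bump a b n x \<partial>L01) = 0" for n
      using orth[OF bump_test[OF ab(1,3)]] by (simp add: ip_def)
    ultimately have 0: "(\<integral>x. w x * (if a < x \<and> x < b then 1 else 0) \<partial>L01) = 0"
      by (simp add: LIMSEQ_const_iff)
    have "J w b - J w a = (\<integral>x. (if x \<le> b then w x else 0) - (if x \<le> a then w x else 0) \<partial>L01)"
      unfolding J_def by (rule Bochner_Integration.integral_diff[symmetric]) (rule J_integrable[OF w])+
    also have "\<dots> = (\<integral>x. w x * (if a < x \<and> x < b then 1 else 0) \<partial>L01)"
    proof (rule integral_cong_AE)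
      show "AE x in L01. (if x \<le> b then w x else 0) - (if x \<le> a then w x else 0) = w x * (if a < x \<and> x < b then 1 else 0)"
        using AE_L01_neq[of b] by eventually_elim (use ab in auto)
      show "(\<lambda>x. w x * (if a < x \<and> x < b then 1 else 0)) \<in> borel_measurable L01"
        using w by (intro borel_measurable_times L2_measurable borel_measurable_L01) auto
    qed (use J_integrable[OF w] in auto)
    finally show ?thesis using 0 by simp
  qed
  have const: "J w x = J w (1/2)" if "x \<in> {0<..<1}" for x
  proof (cases x "1/2 :: real" rule: linorder_cases)
    case less
    then show ?thesis using eq[of x "1/2"] that by simp
  next
    case equal
    then show ?thesis by (simp only:)
  next
    case greater
    then show ?thesis using eq[of "1/2" x] that by simp
  qed
  have cl: "J w x = J w (1/2)" if "x \<in> {0..1}" for x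
  proof (rule continuous_constant_on_closure[OF _ const])
    show "continuous_on (closure {0<..<1}) (J w)" using J_continuous[OF w] by simp
    show "x \<in> closure {0<..<1}" using that by simp
  qed
  have "J w x = 0" if "x \<in> {0..1}" for x
    unfolding cl[OF that] cl[of 0, symmetric, simplified] by simp
  then show ?thesis by (rule J_zero_imp_AE_zero[OF w])
qed

text \<open>A test function of integral zero is the derivative of a test function. Subtracting a
  multiple of one fixed bump \<open>\<psi>\<close> enforces integral zero, and this correction
  reappears as the constant \<open>c\<close>.\<close>

lemma du_Bois_Reymond:
  assumes w: "w \<in> L2" and orth: "\<And>\<phi>. \<phi> \<in> test_functions \<Longrightarrow> ip w (deriv \<phi>) = 0"
  shows "\<exists>c. AE x in L01. w x = c"
proof -
  define \<psi> where "\<psi> = bump (1/3) (2/3) 0"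
  have \<psi>: "\<psi> \<in> test_functions" unfolding \<psi>_def by (intro bump_test) auto
  define I where "I = J \<psi> 1"
  have "I \<noteq> 0"
  proof
    assume "I = 0"
    \<comment> \<open>\<open>J \<psi>\<close> would be strictly increasing where the bump is
      positive, yet equal to 0 at both \<open>1/3\<close> and \<open>2/3\<close>.\<close>
    then have der: "(J \<psi> has_real_derivative \<psi> x) (at x)" for x
      using test_has_deriv[OF test_J(1)[OF \<psi>]] test_J(2)[OF \<psi>] by (simp add: I_def)
    have "J \<psi> (1/3) = J \<psi> 0" "J \<psi> 1 = J \<psi> (2/3)"
      using bump_zero by (intro J_constant_on[OF test_L2[OF \<psi>]]; simp add: \<psi>_def)+
    moreover have "J \<psi> (1/3) < J \<psi> (2/3)"
    proof (rule DERIV_pos_imp_increasing_open[where f = "J \<psi>" and a = "1/3" and b = "2/3"])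
      show "\<exists>y. (J \<psi> has_real_derivative y) (at x) \<and> 0 < y" if "1/3 < x" "x < 2/3" for x
        using der[of x] bump_pos[OF that, of 0] by (auto simp: \<psi>_def)
      show "continuous_on {1/3..2/3} (J \<psi>)"
        using der by (meson DERIV_isCont continuous_at_imp_continuous_on)
    qed simp
    ultimately show False using \<open>I = 0\<close> by (simp add: I_def)
  qed
  define c where "c = ip w \<psi> / I"
  have "ip (\<lambda>x. w x - c) \<phi> = 0" if \<phi>: "\<phi> \<in> test_functions" for \<phi>
  proof -
    define \<eta> where "\<eta> = (\<lambda>x. \<phi> x - J \<phi> 1 / I * \<psi> x)"
    have \<eta>: "\<eta> \<in> test_functions" unfolding \<eta>_def by (rule test_diff_cmult[OF \<phi> \<psi>])
    have "J \<eta> 1 = J \<phi> 1 - J \<phi> 1 / I * J \<psi> 1"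
      unfolding \<eta>_def J_diff[OF test_L2[OF \<phi>] L2_cmult[OF test_L2[OF \<psi>]]] J_cmult ..
    then have "J \<eta> 1 = 0" using \<open>I \<noteq> 0\<close> by (simp add: I_def)
    then have "ip w \<eta> = 0" using orth[OF test_J(1)[OF \<eta>]] test_J(2)[OF \<eta>] by simp
    moreover have "ip w \<eta> = ip w \<phi> - J \<phi> 1 / I * ip w \<psi>"
      unfolding \<eta>_def ip_diff_right[OF test_L2[OF \<phi>] L2_cmult[OF test_L2[OF \<psi>]] w] ip_cmult_right ..
    moreover have "ip (\<lambda>x. w x - c) \<phi> = ip w \<phi> - c * J \<phi> 1"
      using ip_diff_left[OF w L2_const[of c] test_L2[OF \<phi>]] ip_cmult_left[of c "\<lambda>_. 1" \<phi>]
      by (simp add: J_1 ip_commute[of \<phi>])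
    ultimately show ?thesis by (simp add: c_def)
  qed
  from fundamental_lemma[OF L2_diff[OF w L2_const] this] show ?thesis by auto
qed

subsection \<open>Weak derivatives and boundary values\<close>

lemma is_weak_deriv_ip:
  "is_weak_deriv \<alpha> u v \<longleftrightarrow> u \<in> L2 \<and> v \<in> L2 \<and> (\<forall>\<phi>\<in>test_functions. ip u ((deriv ^^ \<alpha>) \<phi>) = (-1) ^ \<alpha> * ip v \<phi>)"
  by (simp add: is_weak_deriv_def ip_def)

lemma weak_deriv_unique:
  assumes "is_weak_deriv \<alpha> u v" "is_weak_deriv \<alpha> u w"
  shows "AE x in L01. v x = w x"
proof -
  have L: "v \<in> L2" "w \<in> L2" using assms by (auto simp: is_weak_deriv_ip)
  have "ip (\<lambda>x. v x - w x) \<phi> = 0" if "\<phi> \<in> test_functions" for \<phi>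
  proof -
    have "(-1) ^ \<alpha> * ip v \<phi> = (-1) ^ \<alpha> * ip w \<phi>"
      using assms that by (metis is_weak_deriv_ip)
    then show ?thesis using L test_L2[OF that] by (simp add: ip_diff_left)
  qed
  from fundamental_lemma[OF L2_diff[OF L] this] show ?thesis by simp
qed

lemma ip_J_deriv:
  assumes v: "v \<in> L2" and \<phi>: "\<phi> \<in> test_functions"
  shows "ip (\<lambda>x. c + J v x) (deriv \<phi>) = - ip v \<phi>"
proof -
  have d: "deriv \<phi> \<in> L2" by (intro test_L2 test_deriv \<phi>)
  obtain a b where ab: "0 < a" "a < b" "b < 1" "\<And>x. x < a \<or> b < x \<Longrightarrow> \<phi> x = 0"
    by (rule test_support[OF \<phi>]) blast
  have J: "J (deriv \<phi>) x = \<phi> x" if "x \<in> {0..1}" for x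
    using J_antiderivative[OF d, of 0 x \<phi>] that ab test_has_deriv[OF \<phi>] test_continuous[OF \<phi>] by auto
  have "J (deriv \<phi>) 1 = 0" using J[of 1] ab by simp
  then have "ip (J v) (deriv \<phi>) = - ip v (J (deriv \<phi>))"
    using ip_J[OF v d] by simp
  also have "ip v (J (deriv \<phi>)) = ip v \<phi>"
    unfolding ip_def using J by (intro Bochner_Integration.integral_cong) auto
  finally show ?thesis
    using ip_add_left[OF L2_const J_L2[OF v] d, of c] ip_cmult_left[of c "\<lambda>_. 1" "deriv \<phi>"]
      \<open>J (deriv \<phi>) 1 = 0\<close> by (simp add: J_1 ip_commute[of "deriv \<phi>"])
qed

lemma weak_deriv_1_antiderivative:
  assumes "is_weak_deriv 1 u v"
  obtains c where "AE x in L01. u x = c + J v x"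
proof -
  have L: "u \<in> L2" "v \<in> L2" using assms by (auto simp: is_weak_deriv_ip)
  have "ip (\<lambda>x. u x - J v x) (deriv \<phi>) = 0" if "\<phi> \<in> test_functions" for \<phi>
  proof -
    have "ip u (deriv \<phi>) = - ip v \<phi>" using assms that by (simp add: is_weak_deriv_ip)
    then show ?thesis
      using ip_J_deriv[OF L(2) that, of 0] L J_L2[OF L(2)] test_L2[OF test_deriv[OF that]]
      by (simp add: ip_diff_left)
  qed
  then obtain c where "AE x in L01. u x - J v x = c"
    using du_Bois_Reymond[OF L2_diff[OF L(1) J_L2[OF L(2)]]] by blast
  then have "AE x in L01. u x = c + J v x" by eventually_elim auto
  then show thesis by (rule that)
qed

lemma antiderivative_weak_deriv_1:
  assumes "u \<in> L2" "v \<in> L2" "AE x in L01. u x = c + J v x"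
  shows "is_weak_deriv 1 u v"
proof -
  have "ip u (deriv \<phi>) = - ip v \<phi>" if \<phi>: "\<phi> \<in> test_functions" for \<phi>
  proof -
    have d: "deriv \<phi> \<in> L2" by (intro test_L2 test_deriv \<phi>)
    have "(\<lambda>x. c + J v x) \<in> L2" using assms by (intro L2_add L2_const J_L2)
    then have "ip u (deriv \<phi>) = ip (\<lambda>x. c + J v x) (deriv \<phi>)"
      unfolding ip_def using assms d
      by (intro integral_cong_AE borel_measurable_times L2_measurable) (auto elim: eventually_mono)
    then show ?thesis using ip_J_deriv[OF assms(2) \<phi>] by simp
  qed
  then show ?thesis using assms by (simp add: is_weak_deriv_ip)
qed

text \<open>\<open>sobolev\<close> relates each derivative to \<open>u\<close> itself; testing with
  \<open>deriv \<phi>\<close> in place of \<open>\<phi>\<close> links consecutive derivatives to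
  each other.\<close>

lemma weak_deriv_step:
  assumes "is_weak_deriv \<alpha> u v" "is_weak_deriv (Suc \<alpha>) u w"
  shows "is_weak_deriv 1 v w"
proof -
  have "ip v (deriv \<phi>) = - ip w \<phi>" if \<phi>: "\<phi> \<in> test_functions" for \<phi>
  proof -
    have "(-1) ^ \<alpha> * ip v (deriv \<phi>) = ip u ((deriv ^^ \<alpha>) (deriv \<phi>))"
      using assms(1) test_deriv[OF \<phi>] by (simp add: is_weak_deriv_ip)
    also have "\<dots> = ip u ((deriv ^^ Suc \<alpha>) \<phi>)" by (simp add: funpow_swap1)
    also have "\<dots> = (-1) ^ \<alpha> * - ip w \<phi>"
      using assms(2) \<phi> by (simp add: is_weak_deriv_ip del: funpow.simps)
    finally show ?thesis unfolding mult_cancel_left by simp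
  qed
  then show ?thesis using assms by (simp add: is_weak_deriv_ip)
qed

lemma weak_deriv_0: "u \<in> L2 \<Longrightarrow> is_weak_deriv 0 u u"
  by (simp add: is_weak_deriv_ip)

lemma weak_derivI: "is_weak_deriv \<alpha> u v \<Longrightarrow> is_weak_deriv \<alpha> u (weak_deriv \<alpha> u)"
  unfolding weak_deriv_def by (rule someI[of "is_weak_deriv \<alpha> u"])

lemma L2_norm_weak_deriv:
  assumes "is_weak_deriv \<alpha> u v"
  shows "L2_norm (weak_deriv \<alpha> u) = L2_norm v"
  using weak_deriv_unique[OF weak_derivI[OF assms] assms] weak_derivI[OF assms]
  by (intro L2_norm_cong_AE) (auto simp: is_weak_deriv_ip)

text \<open>Continuous representatives are unique, which removes the choice in
  \<open>cont_rep\<close>: the difference of two of them has indefinite integral 0, and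
  differentiating recovers the difference at every point, endpoints included.\<close>

lemma cont_rep_eq:
  assumes w: "continuous_on {0..1} w" "AE x in L01. w x = v x" and x: "x \<in> {0..1}"
  shows "cont_rep v x = w x"
proof -
  have "continuous_on {0..1} (cont_rep v) \<and> (AE x in L01. cont_rep v x = v x)"
    unfolding cont_rep_def by (rule someI[of _ w]) (use w in simp)
  then have c: "continuous_on {0..1} (cont_rep v)" "AE x in L01. cont_rep v x = v x" by auto
  define d where "d = (\<lambda>x. cont_rep v x - w x)"
  have d: "continuous_on {0..1} d" unfolding d_def by (intro continuous_intros c w)
  have "AE x in L01. d x = 0" using c(2) w(2) by eventually_elim (simp add: d_def)
  then have "J d y = 0" for y
    using J_cong_AE[OF L2_continuous_on[OF d], of "\<lambda>_. 0" y] by simp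
  then have "((\<lambda>_. 0) has_vector_derivative d x) (at x within {0..1})"
    using has_vector_derivative_J[OF d, of "\<lambda>_. 0" 0 x] x by simp
  then have "d x = 0"
    using vector_derivative01_eq[OF _ x] has_vector_derivative_const[of 0 "at x within {0..1}"] by metis
  then show ?thesis by (simp add: d_def)
qed

text \<open>A constant plus the integral of the next derivative is the continuous representative.
  Its endpoint values turn the boundary conditions into the hypotheses of
  \<open>chain_approx\<close>.\<close>

lemma sobolev_bc_chain:
  assumes i: "i \<in> {0, 1, 2}" and n: "n \<ge> 1" and u: "u \<in> sobolev_bc r i"
  shows "\<exists>c. \<forall>k<r. (AE x in L01. weak_deriv k u x = c k + J (weak_deriv (Suc k) u) x) \<and>
    (even (k + i) \<longrightarrow> c k = 0) \<and> (even (k + i + half_cells n i) \<longrightarrow> c k + J (weak_deriv (Suc k) u) 1 = 0)"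
proof -
  let ?v = "\<lambda>k. weak_deriv k u"
  have wd: "is_weak_deriv k u (?v k)" if "k \<le> r" for k
    using u that weak_derivI by (auto simp: sobolev_bc_def sobolev_def)
  have "\<exists>c. AE x in L01. ?v k x = c + J (?v (Suc k)) x" if "k < r" for k
    using weak_deriv_1_antiderivative[OF weak_deriv_step[OF wd wd]] that by (metis Suc_leI less_imp_le)
  then obtain c where c: "\<And>k. k < r \<Longrightarrow> AE x in L01. ?v k x = c k + J (?v (Suc k)) x" by metis
  have rep: "cont_rep (?v k) x = c k + J (?v (Suc k)) x" if k: "k < r" and x: "x \<in> {0..1}" for k x
  proof (rule cont_rep_eq[OF _ _ x])
    have "?v (Suc k) \<in> L2" using wd[of "Suc k"] k by (simp add: is_weak_deriv_ip)
    then show "continuous_on {0..1} (\<lambda>x. c k + J (?v (Suc k)) x)"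
      by (intro continuous_intros J_continuous)
    show "AE x in L01. c k + J (?v (Suc k)) x = ?v k x"
      using c[OF k] by eventually_elim simp
  qed
  have "boundary_cond i {..<r} (\<lambda>\<alpha>. cont_rep (?v \<alpha>))"
    using u by (simp add: sobolev_bc_def)
  then have bc: "(even (k + i) \<longrightarrow> cont_rep (?v k) 0 = 0) \<and> (even (k + i + half_cells n i) \<longrightarrow> cont_rep (?v k) 1 = 0)"
    if "k < r" for k
    using that i by (auto simp: boundary_cond_def half_cells_def)
  show ?thesis
  proof (intro exI[of _ c] allI impI conjI c)
    show "c k = 0" if "k < r" "even (k + i)" for k
      using bc[OF that(1)] rep[OF that(1), of 0] that(2) by simp
    show "c k + J (weak_deriv (Suc k) u) 1 = 0" if "k < r" "even (k + i + half_cells n i)" for k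
      using bc[OF that(1)] rep[OF that(1), of 1] that(2) by simp
  qed
qed

section \<open>Error bounds for the Ritz projection in both norms\<close>

theorem theorem4p2:
  fixes i n r :: nat and u :: "real \<Rightarrow> real"
  assumes "i \<in> {0, 1, 2}" and "n \<ge> 1" and "r \<ge> 1"
    and "u \<in> sobolev_bc r i"
  shows "\<forall>p. p \<ge> max (r - 1) 1 \<longrightarrow>
           (\<exists>R \<in> spline_opt p n i. \<forall>l \<in> {0, 1}.
              L2_norm (weak_deriv l (\<lambda>x. u x - R x))
                \<le> (h_opt n i / pi) ^ (r - l) * L2_norm (weak_deriv r u))"
proof (intro allI impI)
  fix p assume p: "p \<ge> max (r - 1) 1"
  obtain r' where r: "r = Suc r'" using assms(3) by (cases r) auto
  obtain q where q: "p = Suc q" using p by (cases p) auto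
  \<comment> \<open>The derivative of \<open>u\<close> is approximated in degree
    \<open>q = p - 1\<close> and has \<open>r - 1\<close> derivatives left;
    \<open>chain_approx\<close> then asks for exactly \<open>r - 1 \<le> p\<close>.\<close>
  have rq: "r' \<le> Suc q" using p r q by simp
  define M where "M = half_cells n i"
  have M: "M > 0" using assms(2) by (auto simp: M_def half_cells_def)
  define \<mu> where "\<mu> = 2 / (real M * pi)"
  have h: "h_opt n i / pi = \<mu>"
    using assms(1,2) by (auto simp: \<mu>_def M_def half_cells_def h_opt_def field_simps)
  define v where "v = (\<lambda>k. weak_deriv k u)"
  have wd: "is_weak_deriv k u (v k)" if "k \<le> r" for k
    using assms(4) that weak_derivI by (auto simp: v_def sobolev_bc_def sobolev_def)
  have vL: "v k \<in> L2" if "k \<le> r" for k using wd[OF that] by (simp add: is_weak_deriv_ip)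
  have uL: "u \<in> L2" using wd[of 0] by (simp add: is_weak_deriv_ip)
  obtain c where c: "\<And>k. k < r \<Longrightarrow> AE x in L01. v k x = c k + J (v (Suc k)) x"
    "\<And>k. k < r \<Longrightarrow> even (k + i) \<Longrightarrow> c k = 0"
    "\<And>k. k < r \<Longrightarrow> even (k + i + M) \<Longrightarrow> c k + J (v (Suc k)) 1 = 0"
    using sobolev_bc_chain[OF assms(1,2,4)] unfolding v_def M_def by blast
  have "\<exists>t\<in>sp M q (Suc i). L2_norm (\<lambda>x. v (Suc 0) x - t x) \<le> (2 / (real M * pi)) ^ r' * L2_norm (v (Suc r'))"
  proof (rule chain_approx[OF M, of r' "\<lambda>k. v (Suc k)" "\<lambda>k. c (Suc k)"])
    show "c (Suc k) = 0" if "k < r'" "even (k + Suc i)" for k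
      using c(2)[of "Suc k"] that r by simp
    show "c (Suc k) + J (v (Suc (Suc k))) 1 = 0" if "k < r'" "even (k + Suc i + M)" for k
      using c(3)[of "Suc k"] that r by simp
  qed (use vL c(1) r rq in auto)
  then obtain t where t: "t \<in> sp M q (Suc i)" "L2_norm (\<lambda>x. v 1 x - t x) \<le> \<mu> ^ r' * L2_norm (v r)"
    by (auto simp: \<mu>_def r)
  \<comment> \<open>\<open>weak_deriv 0 u\<close> is a chosen function and agrees with
    \<open>u\<close> only almost everywhere.\<close>
  have u0: "AE x in L01. u x = v 0 x"
    by (rule weak_deriv_unique[OF weak_deriv_0[OF uL] wd]) simp
  then have u1: "AE x in L01. u x = c 0 + J (v 1) x"
    using c(1)[of 0] r by (auto elim: eventually_elim2)
  have c0: "even i \<Longrightarrow> c 0 = 0" "even (i + M) \<Longrightarrow> c 0 + J (v 1) 1 = 0"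
    using c(2,3)[of 0] r by auto
  have v1: "v 1 \<in> L2" using vL[of 1] r by simp
  obtain R f where R: "R \<in> sp M (Suc q) i" and f: "f \<in> L2" "L2_norm f \<le> \<mu> ^ r' * L2_norm (v r)"
    "L2_norm (K M i f) \<le> \<mu> * (\<mu> ^ r' * L2_norm (v r))" "AE x in L01. u x - R x = K M i f x"
    using chain_step[OF M uL v1 u1 c0 t, folded \<mu>_def] by blast
  have RL: "R \<in> L2" using R sp_L2 by auto
  let ?e = "\<lambda>x. u x - R x"
  have eL: "?e \<in> L2" by (rule L2_diff[OF uL RL])
  \<comment> \<open>The weak derivative of \<open>K M i f\<close> may be \<open>f\<close> minus its
    mean rather than \<open>f\<close>; the norm bound survives this.\<close>
  obtain d g where g: "g \<in> L2" "L2_norm g \<le> L2_norm f" "\<And>x. x \<in> {0..1} \<Longrightarrow> K M i f x = d + J g x"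
    using K_form[OF f(1), of i M] by blast
  have "AE x in L01. ?e x = d + J g x"
    using f(4) AE_space by eventually_elim (simp add: g(3))
  then have "is_weak_deriv 1 ?e g"
    by (rule antiderivative_weak_deriv_1[OF eL g(1)])
  then have "L2_norm (weak_deriv 1 ?e) \<le> \<mu> ^ (r - 1) * L2_norm (v r)"
    using g(2) f(2) r by (simp add: L2_norm_weak_deriv)
  moreover have "L2_norm (weak_deriv 0 ?e) \<le> \<mu> ^ r * L2_norm (v r)"
    using L2_norm_weak_deriv[OF weak_deriv_0[OF eL]] L2_norm_cong_AE[OF eL f(4)] f(3) r by (simp add: mult.assoc)
  moreover have "R \<in> spline_opt p n i"
    using sp_spline_opt[OF assms(1,2)] R unfolding q M_def .
  ultimately show "\<exists>R\<in>spline_opt p n i. \<forall>l\<in>{0, 1}. L2_norm (weak_deriv l (\<lambda>x. u x - R x))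
      \<le> (h_opt n i / pi) ^ (r - l) * L2_norm (weak_deriv r u)"
    unfolding h v_def by (intro bexI[of _ R]) auto
qed

end
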